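(* Let $N = q^k n^2$ be an odd perfect number given in Eulerian form, and suppose the smallest prime factor $u$ of $N$ satisfies $u \geq 5$. Then $q < n$.
   Context: For a positive integer $x$, $\sigma(x)$ denotes the sum of the positive divisors of $x$. A positive integer $N$ is perfect if $\sigma(N) = 2N$. An odd perfect number $N$ is said to be given in Eulerian form if $N = q^k n^2$ where $q$ is a prime, $q \equiv k \equiv 1 \pmod 4$, $n$ is a positive integer, and $\gcd(q,n) = 1$. *)

theory Defs
  imports "HOL-Computational_Algebra.Primes"
begin

definition sigma :: "nat \<Rightarrow> nat" where
  "sigma x = (\<Sum>d \<in> {d. d dvd x}. d)"

definition perfect :: "nat \<Rightarrow> bool" where
  "perfect N \<longleftrightarrow> N > 0 \<and> sigma N = 2 * N"

definition eulerian_form :: "nat \<Rightarrow> nat \<Rightarrow> nat \<Rightarrow> nat \<Rightarrow> bool" where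
  "eulerian_form N q k n \<longleftrightarrow> odd N \<and> perfect N \<and> N = q ^ k * n ^ 2 \<and> prime q
     \<and> q mod 4 = 1 \<and> k mod 4 = 1 \<and> n > 0 \<and> coprime q n"

end

theory Submission
  imports Defs "HOL-Number_Theory.Number_Theory"
begin

text \<open>
  For \<open>k \<ge> 5\<close> the divisibility of \<open>2 n\<^sup>2\<close> by \<open>\<sigma>(q\<^sup>k)\<close> is enough. For \<open>k = 1\<close> and \<open>q \<ge> n\<close>, the prime \<open>q\<close> divides
  some \<open>\<sigma>(p\<^bsup>2a\<^esup>)\<close>, where \<open>n = p\<^sup>a s\<close> and \<open>p\<close> does not divide \<open>s\<close>; comparing sizes and powers of \<open>p\<close>
  forces \<open>\<sigma>(s\<^sup>2) = p\<^bsup>2a\<^esup>\<close> and \<open>\<sigma>(p\<^bsup>2a\<^esup>) = 2 s\<^sup>2 - 1\<close>.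

  Hence every prime power \<open>r\<^bsup>l-1\<^esup>\<close> exactly dividing \<open>s\<^sup>2\<close> satisfies \<open>(r\<^sup>l - 1) / (r - 1) = p\<^sup>j\<close> for some
  \<open>j \<ge> 1\<close>, so \<open>r\<^sup>l = 1 + (r - 1) p\<^sup>j\<close>. The Fermat quotient modulo \<open>p\<close> is additive; it vanishes at \<open>r\<close> when
  \<open>j \<ge> 2\<close> (as \<open>p\<close> does not divide \<open>l\<close>) and equals \<open>-(r - 1) / l\<close> when \<open>j = 1\<close>. Evaluating it
  at \<open>s\<^sup>2\<close>, where \<open>2 s\<^sup>2 = 2 + p + p\<^sup>2 + \<dots> + p\<^bsup>2a\<^esup>\<close> gives the value \<open>-1/2\<close>, yields
  \<open>2 \<Sum> (r - 1) (1 - 1/l) = 1\<close> modulo \<open>p\<close>, summed over the \<open>r\<close> with \<open>j = 1\<close>. After multiplication by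
  the product \<open>\<Lambda>\<close> of the \<open>l\<close>, both sides are distinct integers whose difference is less than \<open>p\<close>,
  a contradiction. For this last estimate, the \<open>l\<close> are distinct primes, and \<open>\<Lambda>\<close> and the \<open>r\<close> divide
  \<open>p - 1\<close>, where \<open>p\<close> is about \<open>r\<^bsup>l-1\<^esup>\<close> for each of the \<open>r\<close>.
\<close>

subsection \<open>Reduction to a chain of two values of sigma\<close>

lemma sigma_mult:
  assumes "coprime a b" "a > 0" "b > 0"
  shows "sigma (a * b) = sigma a * sigma b"
proof -
  let ?D = "\<lambda>x::nat. {d. d dvd x}"
  have inj: "inj_on (\<lambda>(d, e). d * e) (?D a \<times> ?D b)"
  proof (rule inj_onI, clarify)
    fix d e d' e'
    assume d: "d dvd a" "e dvd b" "d' dvd a" "e' dvd b" and eq: "d * e = d' * e'"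
    have "coprime d e'" "coprime d' e"
      using d assms(1) by (meson coprime_divisors)+
    then have "d dvd d'" "d' dvd d"
      using eq by (metis coprime_dvd_mult_left_iff dvd_triv_left)+
    then have "d = d'" by (rule dvd_antisym)
    moreover have "d > 0" using d assms by (auto intro: dvd_pos_nat)
    ultimately show "d = d' \<and> e = e'" using eq by simp
  qed
  have img: "(\<lambda>(d, e). d * e) ` (?D a \<times> ?D b) = ?D (a * b)"
  proof (intro equalityI subsetI)
    fix x assume "x \<in> ?D (a * b)"
    then obtain d e where "x = d * e" "d dvd a" "e dvd b"
      using division_decomp[of x a b] by auto
    then show "x \<in> (\<lambda>(d, e). d * e) ` (?D a \<times> ?D b)" by (intro image_eqI[of _ _ "(d, e)"]) auto
  qed (auto intro: mult_dvd_mono)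
  have "sigma a * sigma b = (\<Sum>(d, e) \<in> ?D a \<times> ?D b. d * e)"
    by (simp add: sigma_def sum_product sum.cartesian_product)
  also have "\<dots> = sigma (a * b)"
    unfolding sigma_def img[symmetric] by (subst sum.reindex[OF inj]) (simp add: case_prod_unfold)
  finally show ?thesis ..
qed

lemma sigma_prime_power:
  assumes "prime p"
  shows "sigma (p ^ m) = (\<Sum>i\<le>m. p ^ i)"
proof -
  have "{d. d dvd p ^ m} = (\<lambda>i. p ^ i) ` {..m}"
    using divides_primepow_nat[OF assms] by auto
  moreover have "inj_on (\<lambda>i. p ^ i) {..m}"
    using assms by (auto intro!: inj_onI dest: prime_power_inj)
  ultimately show ?thesis unfolding sigma_def by (simp add: sum.reindex)
qed

lemma sigma_prime_factors:
  assumes "n > 0"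
  shows "sigma n = (\<Prod>p\<in>prime_factors n. sigma (p ^ multiplicity p n))"
proof -
  have "sigma (\<Prod>p\<in>A. p ^ f p) = (\<Prod>p\<in>A. sigma (p ^ f p))"
    if "finite A" "\<forall>p\<in>A. prime p" for A and f :: "nat \<Rightarrow> nat"
    using that
  proof (induction A rule: finite_induct)
    case empty
    then show ?case by (simp add: sigma_def)
  next
    case (insert x F)
    have "coprime (x ^ f x) (\<Prod>p\<in>F. p ^ f p)"
      using insert by (intro prod_coprime_right coprime_power_left_iff[THEN iffD2] disjI1
          coprime_power_right_iff[THEN iffD2]) (auto intro: primes_coprime)
    moreover have "x ^ f x > 0" "(\<Prod>p\<in>F. p ^ f p) > 0"
      using insert by (auto intro!: prod_pos simp: prime_gt_0_nat)
    ultimately show ?case using insert by (simp add: sigma_mult)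
  qed
  from this[of "prime_factors n" "\<lambda>p. multiplicity p n"] show ?thesis
    using prime_factorization_nat[of n] assms by auto
qed

lemma geometric_sum_nat:
  assumes "x > 0"
  shows "(x - 1) * (\<Sum>i\<le>m. x ^ i) + 1 = (x::nat) ^ Suc m"
proof (induction m)
  case (Suc m)
  have "(x - 1) * (\<Sum>i\<le>Suc m. x ^ i) + 1 = x ^ Suc m + (x - 1) * x ^ Suc m"
    using Suc by (simp add: distrib_left)
  also have "\<dots> = x * x ^ Suc m" using assms by (cases x) auto
  finally show ?case by simp
qed (use assms in auto)

lemma sigma_prime_power_geometric:
  assumes "prime p"
  shows "(p - 1) * sigma (p ^ m) + 1 = p ^ Suc m"
  using geometric_sum_nat[of p m] assms by (simp add: sigma_prime_power prime_gt_0_nat)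

text \<open>The ratio to \<open>p ^ m\<close> is below \<open>p / (p - 1)\<close>, which is at most
  5/4 for \<open>p \<ge> 5\<close>.\<close>

lemma sigma_prime_power_less:
  assumes "prime p" "p \<ge> 5"
  shows "4 * sigma (p ^ m) < 5 * p ^ m"
proof -
  let ?x = "sigma (p ^ m)"
  have "(p - 1) * (4 * ?x) < 4 * p * p ^ m"
    using sigma_prime_power_geometric[OF assms(1), of m] by simp
  also have "\<dots> \<le> (p - 1) * (5 * p ^ m)"
  proof -
    have "4 * p \<le> 5 * (p - 1)" using assms by simp
    then have "4 * p * p ^ m \<le> 5 * (p - 1) * p ^ m" by (rule mult_le_mono1)
    then show ?thesis by (simp add: ac_simps)
  qed
  finally show ?thesis by simp
qed

lemma sigma_prime_power_greater:
  assumes "prime p" "m > 0"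
  shows "p ^ m < sigma (p ^ m)"
proof -
  have "(\<Sum>i\<in>{0, m}. p ^ i) \<le> (\<Sum>i\<le>m. p ^ i)" by (rule sum_mono2) auto
  then show ?thesis using assms by (simp add: sigma_prime_power)
qed

text \<open>With \<open>sigma (p ^ (2 * a)) = q * t\<close>, the bound \<open>n \<le> q\<close>
  keeps \<open>t * s\<close> below 5/4 of \<open>p ^ a\<close>, whereas the equation makes
  \<open>p ^ (2 * a)\<close> divide \<open>sigma (s\<^sup>2) * (q + 1)\<close>. Sizes and
  congruences then leave only the value 1 for the remaining cofactors.\<close>

lemma odd_perfect_reduction:
  fixes q n :: nat
  assumes q: "prime q" and n: "n > 0" and eq: "(q + 1) * sigma (n\<^sup>2) = 2 * q * n\<^sup>2"
    and ge: "n \<le> q" and five: "\<And>u. prime u \<Longrightarrow> u dvd n \<Longrightarrow> 5 \<le> u"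
  obtains p a s where "prime p" "p dvd n" "a > 0" "n = p ^ a * s" "\<not> p dvd s"
    "sigma (s\<^sup>2) = p ^ (2 * a)" "sigma (p ^ (2 * a)) + 1 = 2 * s\<^sup>2"
proof -
  have "coprime q (q + 1)" by simp
  then have "q dvd sigma (n\<^sup>2)"
    using eq by (metis coprime_dvd_mult_right_iff dvd_triv_left mult.assoc mult.left_commute)
  then have "q dvd (\<Prod>p\<in>prime_factors (n\<^sup>2). sigma (p ^ multiplicity p (n\<^sup>2)))"
    using n by (simp add: sigma_prime_factors[symmetric])
  then obtain p where p: "p \<in> prime_factors n" and qp: "q dvd sigma (p ^ multiplicity p (n\<^sup>2))"
    using q n by (auto simp: prime_dvd_prod_iff prime_factors_power)
  define a where "a = multiplicity p n"
  have pp: "prime p" "p dvd n" using p by auto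
  have p5: "5 \<le> p" using pp five by auto
  have "a > 0" unfolding a_def using pp n by (simp add: prime_multiplicity_gt_zero_iff)
  have "multiplicity p (n\<^sup>2) = 2 * a"
    unfolding a_def using pp n by (simp add: prime_elem_multiplicity_power_distrib)
  with qp obtain t where t: "sigma (p ^ (2 * a)) = q * t" by auto
  obtain s where s: "n = p ^ a * s" "\<not> p dvd s"
    unfolding a_def using n pp multiplicity_decompose'[of n p] by (metis not_prime_unit not_gr_zero)
  have s0: "s > 0" using s n by auto
  define P where "P = p ^ (2 * a)"
  define S where "S = sigma P"
  define S' where "S' = sigma (s\<^sup>2)"
  have P0: "P > 0" unfolding P_def using pp by (simp add: prime_gt_0_nat)
  have n2: "n\<^sup>2 = P * s\<^sup>2" unfolding P_def s by (simp add: power_mult_distrib power_mult[symmetric] mult.commute)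
  have "coprime P (s\<^sup>2)" unfolding P_def using pp s by (simp add: prime_imp_coprime)
  then have sn: "sigma (n\<^sup>2) = S * S'" unfolding n2 S_def S'_def using P0 s0 by (simp add: sigma_mult)
  have St: "S = q * t" unfolding S_def P_def by (fact t)
  have q0: "q > 0" using q by (simp add: prime_gt_0_nat)
  have e1: "t * S' * (q + 1) = 2 * P * s\<^sup>2"
  proof -
    have "q * (t * S' * (q + 1)) = q * (2 * P * s\<^sup>2)" using eq[unfolded sn, unfolded n2 St] by (simp add: algebra_simps)
    then show ?thesis using q0 by simp
  qed
  have S5: "4 * S < 5 * P" unfolding S_def P_def using pp p5 by (intro sigma_prime_power_less)
  have SP: "P < S" unfolding S_def P_def using pp \<open>a > 0\<close> by (intro sigma_prime_power_greater) auto
  have PP: "P = p ^ a * p ^ a" unfolding P_def by (simp add: mult_2 power_add)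
  have ts: "4 * (t * s) < 5 * p ^ a"
  proof -
    have "p ^ a * (4 * (t * s)) = 4 * (n * t)" using s by simp
    also have "\<dots> \<le> 4 * S" unfolding St using ge by simp
    also have "\<dots> < p ^ a * (5 * p ^ a)" using S5 PP by simp
    finally show ?thesis by simp
  qed
  have ts2: "16 * (t\<^sup>2 * s\<^sup>2) < 25 * P"
  proof -
    have "(4 * (t * s))\<^sup>2 < (5 * p ^ a)\<^sup>2" using ts by (intro power_strict_mono) auto
    then show ?thesis unfolding PP by (simp add: power2_eq_square algebra_simps)
  qed
  \<comment> \<open>\<open>S / P > 1\<close> and \<open>q / (q + 1) < 1\<close> both push
    \<open>S' / s\<^sup>2\<close> below 2.\<close>
  have S'2: "S' < 2 * s\<^sup>2"
  proof (rule ccontr)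
    assume "\<not> ?thesis"
    then have "P * (2 * s\<^sup>2) \<le> S * S'" using SP by (intro mult_le_mono) auto
    then have "(q + 1) * (P * (2 * s\<^sup>2)) \<le> (q + 1) * (S * S')" by (rule mult_le_mono2)
    also have "\<dots> = q * (P * (2 * s\<^sup>2))" using eq[unfolded sn, unfolded n2] by (simp add: ac_simps)
    finally show False using P0 s0 by simp
  qed
  have "\<not> p dvd t"
  proof
    assume "p dvd t"
    then have "p dvd S" unfolding St by simp
    moreover have "(p - 1) * S + 1 = p * P"
      using sigma_prime_power_geometric[OF pp(1), of "2 * a"] unfolding S_def P_def by simp
    ultimately have "p dvd 1" by (metis dvd_add_right_iff dvd_mult dvd_triv_left)
    then show False using pp by simp
  qed
  then have "coprime P t" unfolding P_def using pp by (simp add: prime_imp_coprime)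
  moreover have "P dvd t * (S' * (q + 1))" using e1 by (metis dvd_triv_left mult.assoc mult.left_commute)
  ultimately have "P dvd S' * (q + 1)" by (simp add: coprime_dvd_mult_right_iff)
  \<comment> \<open>\<open>v\<close> is the share of \<open>P\<close> that has to divide \<open>q + 1\<close>; the rest of the proof shows \<open>v = t = c = 1\<close>.\<close>
  then obtain u v where uv: "P = u * v" "u dvd S'" "v dvd q + 1"
    using division_decomp by blast
  obtain c where c: "S' = u * c" using uv by auto
  have u0: "u > 0" "v > 0" using uv P0 by auto
  have key: "8 * (t\<^sup>2 * c) < 25 * v"
  proof -
    have "t > 0" using St SP by (cases t) auto
    then have "8 * (t\<^sup>2 * S') < 8 * (t\<^sup>2 * (2 * s\<^sup>2))" using S'2 by simp
    also have "\<dots> < 25 * P" using ts2 by simp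
    finally have "u * (8 * (t\<^sup>2 * c)) < u * (25 * v)" unfolding uv c by (simp add: algebra_simps)
    then show ?thesis by simp
  qed
  have c0: "c > 0"
  proof (rule ccontr)
    assume "\<not> c > 0"
    then have "2 * P * s\<^sup>2 = 0" using e1 c by simp
    then show False using P0 s0 by simp
  qed
  have t0: "t > 0" using St SP by (cases t) auto
  have "v = 1"
  proof (rule ccontr)
    assume "v \<noteq> 1"
    have "v dvd p ^ (2 * a)" using uv P_def by auto
    then obtain b where b: "v = p ^ b" using divides_primepow_nat[OF pp(1)] by auto
    have "b > 0" using \<open>v \<noteq> 1\<close> b by (cases b) auto
    then have "p dvd v" using b by auto
    then have vp: "p \<le> v" using u0 by (simp add: dvd_imp_le)
    \<comment> \<open>Since \<open>S = q * t\<close>, the geometric sum rewrites this multiple of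
      \<open>v\<close> as \<open>p * P + (p - 1) * t - 1\<close>, and \<open>v\<close> divides
      \<open>P\<close>.\<close>
    have "v dvd (p - 1) * (t * (q + 1))" using uv(3) by (intro dvd_mult)
    moreover have "(p - 1) * (t * (q + 1)) + 1 = p * P + (p - 1) * t"
      using sigma_prime_power_geometric[OF pp(1), of "2 * a"] St unfolding S_def P_def
      by (simp add: algebra_simps)
    moreover have "v dvd p * P" using uv by simp
    ultimately have "v dvd p * P + (p - 1) * t - 1" by (metis add_diff_cancel_right')
    then have "int v dvd int (p * P + (p - 1) * t - 1)" by (simp only: of_nat_dvd_iff)
    also have "int (p * P + (p - 1) * t - 1) = int (p * P) + (int ((p - 1) * t) - 1)"
      using P0 p5 by (subst of_nat_diff) (auto simp: Suc_le_eq)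
    finally have "int v dvd int ((p - 1) * t) - 1"
      using \<open>v dvd p * P\<close> by (metis dvd_add_right_iff of_nat_dvd_iff)
    \<comment> \<open>Both \<open>v\<close> and \<open>1 + v * w\<close> are known modulo \<open>p - 1\<close>, which forces \<open>w \<ge> p - 2\<close> and hence \<open>4 * t > 3 * v\<close>.\<close>
    then obtain w where w: "int ((p - 1) * t) - 1 = int v * w" by auto
    have ip: "int (p - 1) = int p - 1" using p5 by simp
    have "int (p - 1) dvd int v - 1"
    proof -
      have "int p - 1 dvd int p ^ b - 1 ^ b" using power_diff_sumr2[of "int p" b 1] by simp
      then show ?thesis using b ip by simp
    qed
    then obtain z where z: "int v - 1 = int (p - 1) * z" by auto
    have "int (p - 1) * (int t - z * w) = 1 + w"
    proof -
      have "1 + w = int ((p - 1) * t) - (int v - 1) * w" using w by (simp add: left_diff_distrib)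
      then show ?thesis unfolding z of_nat_mult by (simp add: right_diff_distrib mult_ac)
    qed
    then have "int (p - 1) dvd 1 + w" by (metis dvd_triv_left)
    moreover have "w \<ge> 0"
    proof -
      have "(p - 1) * t > 0" using t0 p5 by simp
      then have "int v * w \<ge> 0" unfolding w[symmetric] by linarith
      then show ?thesis using u0 by (simp add: zero_le_mult_iff)
    qed
    ultimately have "int (p - 1) \<le> 1 + w" by (simp add: zdvd_imp_le)
    then have w2: "w \<ge> int p - 2" using p5 by simp
    have "int p \<ge> 5" using p5 by simp
    then have "3 * (int p - 1) \<le> 4 * w" using w2 by (simp add: algebra_simps)
    then have "int v * (3 * (int p - 1)) \<le> int v * (4 * w)" by (rule mult_left_mono) simp
    then have "4 * (int v * w) \<ge> int v * (3 * (int p - 1))" by simp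
    then have "4 * ((int p - 1) * int t) > 3 * int v * (int p - 1)"
      
    proof -
      have "(int p - 1) * int t = int v * w + 1" using w[unfolded of_nat_mult ip] by linarith
      then have "4 * ((int p - 1) * int t) = 4 * (int v * w) + 4" by simp
      then show ?thesis using \<open>4 * (int v * w) \<ge> int v * (3 * (int p - 1))\<close> by (simp add: mult_ac)
    qed
    then have "(int p - 1) * (4 * int t) > (int p - 1) * (3 * int v)" by (simp add: algebra_simps)
    then have t4: "4 * t > 3 * v" using p5 by (simp add: mult_less_cancel_left)
    have tv: "8 * t\<^sup>2 < 25 * v"
    proof -
      have "t\<^sup>2 * 1 \<le> t\<^sup>2 * c" using c0 by (intro mult_le_mono2) simp
      then show ?thesis using key by linarith
    qed
    have "(3 * v)\<^sup>2 < (4 * t)\<^sup>2" using t4 by (intro power_strict_mono) auto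
    then have "9 * (v * v) < 16 * t\<^sup>2" by (simp add: power2_eq_square)
    then have "9 * (v * v) < 50 * v" using tv by linarith
    then have "v * (9 * v) < v * 50" by (simp add: mult_ac)
    then have "9 * v < 50" using u0 by (simp only: mult_less_cancel1)
    \<comment> \<open>The bound \<open>9 * v < 50\<close> and \<open>5 \<le> p \<le> v\<close> leave
      one case, where \<open>t \<ge> 4\<close> gives
      \<open>8 * t\<^sup>2 \<ge> 128 > 125\<close>.\<close>
    then have "v = 5" "p = 5" using vp p5 by linarith+
    then have "t \<ge> 4" using t4 by simp
    then have "4\<^sup>2 \<le> t\<^sup>2" by (rule power_mono) simp
    then show False using tv \<open>v = 5\<close> by simp
  qed
  with key have k1: "8 * (t\<^sup>2 * c) < 25" by simp
  have "t = 1"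
  proof (rule ccontr)
    assume "t \<noteq> 1"
    then have "2\<^sup>2 \<le> t\<^sup>2" using t0 by (intro power_mono) auto
    then have "2\<^sup>2 * 1 \<le> t\<^sup>2 * c" using c0 by (intro mult_le_mono) auto
    then show False using k1 by simp
  qed
  then have c3: "c \<le> 3" using k1 by simp
  have e2: "c * (q + 1) = 2 * s\<^sup>2"
  proof -
    have "P * (c * (q + 1)) = P * (2 * s\<^sup>2)"
      using e1 \<open>t = 1\<close> \<open>v = 1\<close> uv c by (simp add: algebra_simps)
    then show ?thesis using P0 by simp
  qed
  have nd: "\<not> 2 dvd s" "\<not> 3 dvd s"
    using five[of 2] five[of 3] s by (auto simp: dvd_mult)
  have "c \<noteq> 3"
  proof
    assume "c = 3"
    then have "3 dvd 2 * s\<^sup>2" using e2 by (metis dvd_triv_left)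
    moreover have "coprime 3 (2::nat)" by (rule primes_coprime) auto
    ultimately have "3 dvd s\<^sup>2" by (simp add: coprime_dvd_mult_right_iff)
    moreover have "prime (3::nat)" by simp
    ultimately have "3 dvd s" using prime_dvd_power by blast
    then show False using nd by simp
  qed
  moreover have "c \<noteq> 2"
  proof
    assume "c = 2"
    then have "q + 1 = s\<^sup>2" using e2 by simp
    moreover have "odd (s\<^sup>2)" using nd by simp
    ultimately have "even q" by (metis even_plus_one_iff)
    then have "q = 2" using q by (metis primes_dvd_imp_eq two_is_prime_nat)
    then have "s\<^sup>2 = 3" using \<open>q + 1 = s\<^sup>2\<close> by simp
    moreover have "s = 0 \<or> s = 1 \<or> s \<ge> 2" by auto
    ultimately show False using power_mono[of 2 s 2] by auto
  qed
  ultimately have "c = 1" using c3 c0 by auto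
  show thesis
  proof (rule that[OF pp \<open>a > 0\<close> s])
    show "sigma (s\<^sup>2) = p ^ (2 * a)" using c \<open>c = 1\<close> \<open>v = 1\<close> uv by (simp add: S'_def P_def)
    show "sigma (p ^ (2 * a)) + 1 = 2 * s\<^sup>2" using e2 \<open>c = 1\<close> St \<open>t = 1\<close> by (simp add: S_def P_def)
  qed
qed

subsection \<open>Fermat quotients\<close>

text \<open>The division is exact, by Fermat's theorem, when \<open>p\<close> is prime and does not
  divide \<open>x\<close>. The class modulo \<open>p\<close> depends on \<open>x\<close> modulo
  \<open>p ^ 2\<close>.\<close>

definition fermat_quotient :: "nat \<Rightarrow> int \<Rightarrow> int" where
  "fermat_quotient p x = (x ^ (p - 1) - 1) div int p"

lemma fermat_quotient_1 [simp]: "fermat_quotient p 1 = 0"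
  by (simp add: fermat_quotient_def)

context
  fixes p :: nat
  assumes p: "prime p"
begin

lemma fermat_quotient:
  assumes "\<not> int p dvd x"
  shows "x ^ (p - 1) = 1 + int p * fermat_quotient p x"
proof -
  define y where "y = nat (x mod int p)"
  have p0: "int p > 0" using p by (simp add: prime_gt_0_nat)
  then have y: "int y = x mod int p" by (simp add: y_def)
  then have "\<not> int p dvd int y" using assms by (simp add: dvd_mod_iff)
  then have "\<not> p dvd y" by (simp add: of_nat_dvd_iff)
  then have "[y ^ (p - 1) = 1] (mod p)" using p by (intro fermat_theorem)
  then have "[int y ^ (p - 1) = 1] (mod int p)" using cong_int_iff by force
  then have "[x ^ (p - 1) = 1] (mod int p)" unfolding y
    by (metis cong_def power_mod)
  then have "int p dvd x ^ (p - 1) - 1" by (simp add: cong_iff_dvd_diff)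
  then show ?thesis by (simp add: fermat_quotient_def)
qed

text \<open>A logarithm law: multiplying two numbers of the form \<open>1 + p * c\<close> adds the
  \<open>c\<close>, up to a multiple of \<open>p\<close>.\<close>

lemma fermat_quotient_mult:
  assumes "\<not> int p dvd x" "\<not> int p dvd y"
  shows "[fermat_quotient p (x * y) = fermat_quotient p x + fermat_quotient p y] (mod int p)"
proof -
  let ?f = "fermat_quotient p"
  have pr: "prime (int p)" using p by simp
  have "\<not> int p dvd x * y" using assms pr by (simp add: prime_dvd_mult_iff)
  then have "1 + int p * ?f (x * y) = (1 + int p * ?f x) * (1 + int p * ?f y)"
    using assms by (simp add: fermat_quotient[symmetric] power_mult_distrib)
  then have "int p * ?f (x * y) = int p * (?f x + ?f y + int p * (?f x * ?f y))"
    by (simp add: algebra_simps)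
  then have "?f (x * y) = ?f x + ?f y + int p * (?f x * ?f y)"
    using p by (simp add: prime_gt_0_nat)
  then show ?thesis by (simp add: cong_def)
qed

lemma fermat_quotient_prod:
  assumes "finite A" "\<And>i. i \<in> A \<Longrightarrow> \<not> int p dvd f i"
  shows "[fermat_quotient p (\<Prod>i\<in>A. f i) = (\<Sum>i\<in>A. fermat_quotient p (f i))] (mod int p)"
  using assms
proof (induction A rule: finite_induct)
  case (insert x A)
  have "\<not> int p dvd (\<Prod>i\<in>A. f i)" using insert p by (simp add: prime_dvd_prod_iff)
  then have "[fermat_quotient p (f x * (\<Prod>i\<in>A. f i))
      = fermat_quotient p (f x) + fermat_quotient p (\<Prod>i\<in>A. f i)] (mod int p)"
    using insert by (intro fermat_quotient_mult) auto
  also have "[fermat_quotient p (f x) + fermat_quotient p (\<Prod>i\<in>A. f i)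
      = fermat_quotient p (f x) + (\<Sum>i\<in>A. fermat_quotient p (f i))] (mod int p)"
    using insert by (intro cong_add cong_refl) auto
  finally show ?case using insert by simp
qed simp

lemma fermat_quotient_power:
  assumes "\<not> int p dvd x"
  shows "[fermat_quotient p (x ^ n) = int n * fermat_quotient p x] (mod int p)"
  using fermat_quotient_prod[of "{..<n}" "\<lambda>_. x"] assms by simp

text \<open>The derivative of the quotient, from the binomial expansion of
  \<open>(x + p * c) ^ (p - 1)\<close> modulo \<open>p ^ 2\<close>. Multiplying by \<open>x\<close>
  avoids inverses modulo \<open>p\<close>.\<close>

lemma fermat_quotient_shift:
  assumes "\<not> int p dvd x"
  shows "[x * fermat_quotient p (x + int p * c) = x * fermat_quotient p x - c] (mod int p)"
proof -
  let ?f = "fermat_quotient p"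
  have taylor: "\<exists>k. x * (x + h) ^ n = x * x ^ n + int n * h * x ^ n + h\<^sup>2 * k" for n and h :: int
  proof (induction n)
    case (Suc n)
    then obtain k where "x * (x + h) ^ n = x * x ^ n + int n * h * x ^ n + h\<^sup>2 * k" by auto
    then have "(x + h) * (x * (x + h) ^ n)
        = (x + h) * (x * x ^ n + int n * h * x ^ n + h\<^sup>2 * k)" by simp
    then have "x * (x + h) ^ Suc n = x * x ^ Suc n + int (Suc n) * h * x ^ Suc n
        + h\<^sup>2 * (int n * x ^ n + (x + h) * k)"
      by (simp add: algebra_simps power2_eq_square)
    then show ?case by blast
  qed (auto intro: exI[of _ 0])
  obtain k where k: "x * (x + int p * c) ^ (p - 1)
      = x * x ^ (p - 1) + int (p - 1) * (int p * c) * x ^ (p - 1) + (int p * c)\<^sup>2 * k"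
    using taylor by blast
  have "\<not> int p dvd x + int p * c" using assms by (metis dvd_add_left_iff dvd_triv_left)
  from k[unfolded fermat_quotient[OF this] fermat_quotient[OF assms]]
  have "int p * (x * ?f (x + int p * c)) = int p * (x * ?f x + int (p - 1) * c * (1 + int p * ?f x)
      + int p * c\<^sup>2 * k)"
    by (simp add: algebra_simps power2_eq_square)
  then have "x * ?f (x + int p * c) = x * ?f x + int (p - 1) * c * (1 + int p * ?f x) + int p * c\<^sup>2 * k"
    using p by (simp add: prime_gt_0_nat)
  also have "\<dots> = x * ?f x - c + int p * (c + int (p - 1) * c * ?f x + c\<^sup>2 * k)"
    using p int_ops(6)[of p 1] prime_ge_1_nat[OF p] by (simp add: algebra_simps)
  finally show ?thesis by (simp add: cong_def)
qed

text \<open>If \<open>p\<close> divided \<open>l\<close>, the factor \<open>(r ^ l - 1) / (r ^ (l / p) - 1)\<close> would be a power of \<open>p\<close>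
  exceeding \<open>p\<close>, but it is congruent to \<open>p\<close> modulo \<open>p ^ 2\<close>.\<close>

lemma not_dvd_exponent_of_repunit_prime_power:
  fixes r j l :: nat
  assumes odd: "odd p" and r: "r \<ge> 2" and j: "j > 0" and l: "l > 0"
    and eq: "(r - 1) * p ^ j + 1 = r ^ l"
  shows "\<not> p dvd l"
proof
  assume "p dvd l"
  then obtain m where m: "l = m * p" by (metis dvd_def mult.commute)
  define y where "y = r ^ m"
  \<comment> \<open>\<open>\<Phi>\<close> is \<open>(y ^ p - 1) / (y - 1)\<close> and
    \<open>G\<close> is \<open>(y - 1) / (r - 1)\<close>, so
    \<open>G * \<Phi> = p ^ j\<close>.\<close>
  define \<Phi> where "\<Phi> = (\<Sum>i<p. y ^ i)"
  define G where "G = (\<Sum>i<m. r ^ i)"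
  have m0: "m > 0" using l m by (cases m) auto
  have p2: "p \<ge> 2" using p by (simp add: prime_ge_2_nat)
  have y2: "y \<ge> 2" using r m0 unfolding y_def
    by (metis Suc_pred one_le_power le_trans mult_le_mono power_Suc nat_mult_1_right one_le_numeral order_trans)
  have "int (y - 1) * int \<Phi> = int y ^ p - 1"
    using y2 power_diff_1_eq[of "int y" p] by (simp add: \<Phi>_def of_nat_diff)
  moreover have "int (r - 1) * int G = int y - 1"
    using r power_diff_1_eq[of "int r" m] by (simp add: G_def y_def of_nat_diff)
  moreover have "int (y - 1) = int y - 1" using y2 by simp
  ultimately have "int (r - 1) * (int G * int \<Phi>) = int y ^ p - 1"
    by (metis mult.assoc)
  then have "int (r - 1) * (int G * int \<Phi>) = int (r ^ l) - 1"
    by (simp add: y_def m power_mult)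
  also have "\<dots> = int (r - 1) * int p ^ j" unfolding eq[symmetric] by simp
  finally have "int G * int \<Phi> = int p ^ j" using r by simp
  then have "G * \<Phi> = p ^ j" by (metis of_nat_eq_iff of_nat_mult of_nat_power)
  then have "\<Phi> dvd p ^ j" by (metis dvd_triv_right)
  then obtain i where i: "\<Phi> = p ^ i" using p divides_primepow_nat by blast
  have "\<Phi> > p"
  proof -
    have "(\<Sum>i<p. (1::nat)) < \<Phi>" unfolding \<Phi>_def
      using p2 y2 by (intro sum_strict_mono_ex1) (auto intro!: bexI[of _ 1] simp: one_le_power)
    then show ?thesis by simp
  qed
  then have "p ^ 1 < p ^ i" using i by simp
  then have "i \<ge> 2" using p2 by (subst (asm) power_strict_increasing_iff) auto
  then have "p\<^sup>2 dvd \<Phi>" unfolding i by (rule le_imp_power_dvd)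
  then have dvd: "(int p)\<^sup>2 dvd int \<Phi>" by (metis of_nat_dvd_iff of_nat_power)
  \<comment> \<open>Modulo \<open>p\<close>, the power \<open>y ^ p\<close> is \<open>y\<close> by
    Fermat and 1 by \<open>eq\<close> with \<open>j > 0\<close>.\<close>
  have "int p dvd int y - 1"
  proof -
    have "\<not> p dvd r"
    proof
      assume "p dvd r"
      then have "p dvd (r - 1) * p ^ j + 1" unfolding eq using l by (meson dvd_power dvd_trans)
      moreover have "p dvd (r - 1) * p ^ j" using j by auto
      ultimately show False using p by (metis dvd_add_right_iff not_prime_unit)
    qed
    then have "\<not> int p dvd int y" unfolding y_def using p
      by (metis of_nat_dvd_iff prime_dvd_power)
    then have "int p dvd int y ^ (p - 1) - 1" using fermat_quotient[of "int y"] by simp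
    then have "int p dvd int y * (int y ^ (p - 1) - 1)" by (rule dvd_mult)
    moreover have "int y * int y ^ (p - 1) = int y ^ p" using p2 by (cases p) auto
    ultimately have "int p dvd int y ^ p - int y" by (simp add: right_diff_distrib)
    moreover have "int p dvd int y ^ p - 1"
    proof -
      have "int y ^ p - 1 = int (r - 1) * int p ^ j"
        using eq by (metis \<open>int (r ^ l) - 1 = int (r - 1) * int p ^ j\<close> m of_nat_power power_mult y_def)
      then show ?thesis using j by (simp add: dvd_mult)
    qed
    ultimately have "int p dvd (int y ^ p - 1) - (int y ^ p - int y)" using dvd_diff by blast
    then show ?thesis by simp
  qed
  then obtain z where z: "int y = 1 + int p * z" by (auto simp: dvd_def algebra_simps)
  have pow: "[int y ^ i = 1 + int i * int p * z] (mod (int p)\<^sup>2)" for i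
  proof (induction i)
    case (Suc i)
    have "[int y * int y ^ i = int y * (1 + int i * int p * z)] (mod (int p)\<^sup>2)"
      using Suc by (intro cong_mult cong_refl)
    also have "int y * (1 + int i * int p * z) = 1 + int (Suc i) * int p * z + (int p)\<^sup>2 * (int i * z\<^sup>2)"
      unfolding z by (simp add: algebra_simps power2_eq_square)
    also have "[\<dots> = 1 + int (Suc i) * int p * z] (mod (int p)\<^sup>2)" by (simp add: cong_def)
    finally show ?case by simp
  qed simp
  have "[int \<Phi> = (\<Sum>i<p. 1 + int i * int p * z)] (mod (int p)\<^sup>2)"
    unfolding \<Phi>_def of_nat_sum of_nat_power by (intro cong_sum pow)
  also have "(\<Sum>i<p. 1 + int i * int p * z) = int p + int p * z * (\<Sum>i<p. int i)"
    by (simp add: sum.distrib sum_distrib_left mult_ac)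
  \<comment> \<open>Oddness of \<open>p\<close> makes this sum a multiple of \<open>p\<close>, so
    the linear term vanishes modulo \<open>p ^ 2\<close>.\<close>
  also have "(\<Sum>i<p. int i) = int p * int ((p - 1) div 2)"
  proof -
    have "2 * (\<Sum>i<n. int i) = int n * (int n - 1)" for n by (induction n) (auto simp: algebra_simps)
    from this[of p] show ?thesis using odd by (auto elim!: oddE)
  qed
  also have "int p + int p * z * (int p * int ((p - 1) div 2))
      = int p + (int p)\<^sup>2 * (z * int ((p - 1) div 2))" by (simp add: power2_eq_square)
  also have "[\<dots> = int p] (mod (int p)\<^sup>2)" by (simp add: cong_def)
  finally have "(int p)\<^sup>2 dvd int p" using dvd by (metis cong_dvd_iff)
  then have "int p * int p \<le> int p * 1" using p2 by (auto simp: power2_eq_square dest!: zdvd_imp_le)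
  then show False using p2 by simp
qed

end

text \<open>\<open>A\<close> collects the bases with \<open>j = 1\<close>. The relation is stated
  after multiplication by the product of the \<open>l r\<close>, so that no inverse modulo
  \<open>p\<close> occurs.\<close>

lemma fermat_quotient_relation:
  fixes p a s :: nat
  defines "l \<equiv> \<lambda>r. 2 * multiplicity r s + 1"
  defines "A \<equiv> {r \<in> prime_factors s. (r - 1) * p + 1 = r ^ l r}"
  assumes p: "prime p" "odd p" and a: "a > 0" and s: "s > 0" "\<not> p dvd s"
    and eq1: "sigma (s\<^sup>2) = p ^ (2 * a)" and eq2: "sigma (p ^ (2 * a)) + 1 = 2 * s\<^sup>2"
  shows "[2 * (\<Sum>r\<in>A. int ((r - 1) * (l r - 1) * (\<Prod>x\<in>A - {r}. l x))) = int (\<Prod>r\<in>A. l r)] (mod int p)"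
proof -
  let ?F = "fermat_quotient p"
  let ?Q = "prime_factors s"
  have finA: "finite A" unfolding A_def by auto
  have ndvd: "\<not> int p dvd int r" if "r \<in> ?Q" for r
  proof -
    have "\<not> p dvd r" using that s by (meson dvd_trans in_prime_factors_iff)
    then show ?thesis by (simp add: of_nat_dvd_iff)
  qed
  \<comment> \<open>\<open>sigma\<close> of a prime power part of \<open>s\<^sup>2\<close> divides
    \<open>sigma (s\<^sup>2)\<close>, a power of \<open>p\<close>, and exceeds 1.\<close>
  have repunit: "\<exists>j>0. (r - 1) * p ^ j + 1 = r ^ l r" if r: "r \<in> ?Q" for r
  proof -
    have pr: "prime r" "r dvd s" using r by auto
    have e: "multiplicity r s > 0" using pr s by (simp add: prime_multiplicity_gt_zero_iff)
    have mult: "multiplicity r (s\<^sup>2) = 2 * multiplicity r s"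
      using pr s by (simp add: prime_elem_multiplicity_power_distrib)
    have "r \<in> prime_factors (s\<^sup>2)" using r s by (simp add: prime_factors_power)
    then have "sigma (r ^ multiplicity r (s\<^sup>2)) dvd sigma (s\<^sup>2)"
      unfolding sigma_prime_factors[of "s\<^sup>2", OF zero_less_power[OF s(1)]]
      by (intro dvd_prodI) auto
    then obtain j where j: "sigma (r ^ (2 * multiplicity r s)) = p ^ j"
      unfolding mult eq1 using divides_primepow_nat[OF p(1)] by blast
    have "r ^ (2 * multiplicity r s) < p ^ j"
      unfolding j[symmetric] using pr e by (intro sigma_prime_power_greater) auto
    then have "j > 0" using pr by (cases j) (auto simp: prime_gt_0_nat)
    moreover have "(r - 1) * p ^ j + 1 = r ^ l r"
      using sigma_prime_power_geometric[OF pr(1), of "2 * multiplicity r s"] j by (simp add: l_def)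
    ultimately show ?thesis by blast
  qed
  \<comment> \<open>\<open>r ^ l r\<close> is \<open>1 + p * c\<close> with
    \<open>c = (r - 1) * p ^ (j - 1)\<close>; shifting from 1 gives the quotient \<open>- c\<close>,
    which vanishes modulo \<open>p\<close> unless \<open>j = 1\<close>.\<close>
  have main: "[int (l r) * ?F (int r) = (if r \<in> A then - int (r - 1) else 0)] (mod int p)"
    if r: "r \<in> ?Q" for r
  proof -
    obtain j where j: "j > 0" "(r - 1) * p ^ j + 1 = r ^ l r" using repunit[OF r] by auto
    have r2: "r \<ge> 2" using r by (simp add: in_prime_factors_iff prime_ge_2_nat)
    let ?c = "int (r - 1) * int p ^ (j - 1)"
    have "int r ^ l r = int ((r - 1) * p ^ j + 1)" by (simp only: j(2) of_nat_power)
    also have "\<dots> = 1 + int p * ?c" using j(1) by (cases j) auto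
    finally have rl: "int r ^ l r = 1 + int p * ?c" .
    have "[int (l r) * ?F (int r) = ?F (int r ^ l r)] (mod int p)"
      using fermat_quotient_power[OF p(1) ndvd[OF r], of "l r"] by (rule cong_sym)
    also have "[?F (int r ^ l r) = - ?c] (mod int p)"
      unfolding rl using fermat_quotient_shift[OF p(1), of 1 ?c] prime_gt_1_nat[OF p(1)] by simp
    also have "[- ?c = (if r \<in> A then - int (r - 1) else 0)] (mod int p)"
    proof (cases "j = 1")
      case True
      then have "r \<in> A" using j r by (simp add: A_def)
      then show ?thesis using True by simp
    next
      case False
      then obtain i where i: "j = Suc (Suc i)" using j(1) by (metis One_nat_def not_gr_zero old.nat.exhaust)
      have "r \<notin> A"
      proof
        assume "r \<in> A"
        then have "(r - 1) * p + 1 = r ^ l r" unfolding A_def by blast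
        with j(2) have "(r - 1) * p ^ j = (r - 1) * p ^ 1" by (metis add_right_cancel power_one_right)
        then have "p ^ j = p ^ 1" using r2 by (simp del: power_one_right)
        then show False using False p prime_power_inj by metis
      qed
      then show ?thesis unfolding i by (simp add: cong_def)
    qed
    finally show ?thesis .
  qed
  \<comment> \<open>\<open>main\<close> only kills \<open>l r\<close> times the quotient; cancelling
    \<open>l r\<close> requires that \<open>p\<close> does not divide it.\<close>
  have zero: "[?F (int r) = 0] (mod int p)" if r: "r \<in> ?Q" "r \<notin> A" for r
  proof -
    obtain j where j: "j > 0" "(r - 1) * p ^ j + 1 = r ^ l r" using repunit[OF r(1)] by auto
    have r2: "r \<ge> 2" using r by (simp add: in_prime_factors_iff prime_ge_2_nat)
    have "\<not> p dvd l r"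
      using not_dvd_exponent_of_repunit_prime_power[OF p r2 j(1) _ j(2)] by (simp add: l_def)
    then have "\<not> int p dvd int (l r)" by (simp add: of_nat_dvd_iff)
    moreover have "int p dvd int (l r) * ?F (int r)"
      using main[OF r(1)] r(2) by (simp add: cong_0_iff)
    moreover have "prime (int p)" using p by simp
    ultimately have "int p dvd ?F (int r)" by (simp add: prime_dvd_mult_iff)
    then show ?thesis by (simp add: cong_0_iff)
  qed
  have ndvd_power: "\<not> int p dvd int r ^ k" if "r \<in> ?Q" for r k
    using prime_dvd_power[of "int p" "int r" k] p ndvd[OF that] by auto
  have "int (s\<^sup>2) = (\<Prod>r\<in>?Q. int r ^ (l r - 1))"
  proof -
    have "s\<^sup>2 = (\<Prod>r\<in>?Q. r ^ multiplicity r s)\<^sup>2" using prime_factorization_nat[OF s(1)] by simp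
    also have "\<dots> = (\<Prod>r\<in>?Q. r ^ (l r - 1))"
      unfolding prod_power_distrib l_def by (simp add: power_mult[symmetric] mult.commute)
    finally show ?thesis by simp
  qed
  also have "[?F (\<Prod>r\<in>?Q. int r ^ (l r - 1)) = (\<Sum>r\<in>?Q. ?F (int r ^ (l r - 1)))] (mod int p)"
    using p ndvd_power by (intro fermat_quotient_prod) auto
  also have "[(\<Sum>r\<in>?Q. ?F (int r ^ (l r - 1))) = (\<Sum>r\<in>?Q. int (l r - 1) * ?F (int r))] (mod int p)"
    using p ndvd by (intro cong_sum fermat_quotient_power) auto
  also have "[(\<Sum>r\<in>?Q. int (l r - 1) * ?F (int r))
      = (\<Sum>r\<in>?Q. if r \<in> A then int (l r - 1) * ?F (int r) else 0)] (mod int p)"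
  proof (intro cong_sum)
    fix r assume "r \<in> ?Q"
    then show "[int (l r - 1) * ?F (int r) = (if r \<in> A then int (l r - 1) * ?F (int r) else 0)] (mod int p)"
      using zero[of r] by (auto simp: cong_0_iff)
  qed
  also have "(\<Sum>r\<in>?Q. if r \<in> A then int (l r - 1) * ?F (int r) else 0)
      = (\<Sum>r\<in>A. int (l r - 1) * ?F (int r))"
    by (subst sum.inter_filter[symmetric]) (auto simp: A_def intro!: sum.cong)
  finally have Fs: "[?F (int (s\<^sup>2)) = (\<Sum>r\<in>A. int (l r - 1) * ?F (int r))] (mod int p)" .
  \<comment> \<open>\<open>2 * s\<^sup>2\<close> is \<open>2 + p * c\<close> with \<open>c\<close>
    congruent to 1; shifting from 2 and the product rule leave \<open>- c\<close> once
    \<open>?F 2\<close> cancels.\<close>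
  have half: "[2 * ?F (int (s\<^sup>2)) = -1] (mod int p)"
  proof -
    let ?c = "\<Sum>i<2 * a. int p ^ i"
    have pr: "prime (int p)" using p by simp
    have nd2: "\<not> int p dvd 2"
    proof
      assume "int p dvd 2"
      then have "p dvd 2" by (metis of_nat_dvd_iff of_nat_numeral)
      then have "p = 2" using p primes_dvd_imp_eq two_is_prime_nat by blast
      then show False using p by simp
    qed
    have nds: "\<not> int p dvd int (s\<^sup>2)" using s p by (metis of_nat_dvd_iff prime_dvd_power)
    have "int (sigma (p ^ (2 * a))) = (\<Sum>i\<le>2 * a. int p ^ i)" using p by (simp add: sigma_prime_power)
    also have "\<dots> = 1 + int p * ?c" by (simp add: sum.atMost_shift sum_distrib_left)
    finally have "2 * int (s\<^sup>2) = 2 + int p * ?c" using arg_cong[OF eq2, of int] by simp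
    then have "[2 * ?F (2 * int (s\<^sup>2)) = 2 * ?F 2 - ?c] (mod int p)"
      using fermat_quotient_shift[OF p(1) nd2, of ?c] by simp
    moreover have "[?F (2 * int (s\<^sup>2)) = ?F 2 + ?F (int (s\<^sup>2))] (mod int p)"
      using p nd2 nds by (intro fermat_quotient_mult)
    then have "[2 * ?F (2 * int (s\<^sup>2)) = 2 * (?F 2 + ?F (int (s\<^sup>2)))] (mod int p)"
      by (intro cong_mult cong_refl)
    ultimately have "[2 * (?F 2 + ?F (int (s\<^sup>2))) = 2 * ?F 2 - ?c] (mod int p)"
      by (rule cong_trans[OF cong_sym, rotated])
    then have "int p dvd 2 * (?F 2 + ?F (int (s\<^sup>2))) - (2 * ?F 2 - ?c)"
      by (simp only: cong_iff_dvd_diff)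
    also have "2 * (?F 2 + ?F (int (s\<^sup>2))) - (2 * ?F 2 - ?c) = 2 * ?F (int (s\<^sup>2)) - (- ?c)"
      by simp
    finally have "[2 * ?F (int (s\<^sup>2)) = - ?c] (mod int p)"
      by (simp only: cong_iff_dvd_diff)
    also have "[- ?c = -1] (mod int p)"
    proof -
      obtain b where b: "2 * a = Suc b" using a by (cases "2 * a") auto
      have "?c = 1 + int p * (\<Sum>i<b. int p ^ i)"
        unfolding b by (simp add: sum.lessThan_Suc_shift sum_distrib_left del: sum.lessThan_Suc)
      then show ?thesis by (simp add: cong_iff_dvd_diff)
    qed
    finally show ?thesis .
  qed
  define \<Lambda> where "\<Lambda> = (\<Prod>r\<in>A. l r)"
  \<comment> \<open>The factor \<open>l r\<close> of \<open>\<Lambda>\<close> is what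
    \<open>main\<close> needs, so nothing is divided by \<open>l r\<close>.\<close>
  have summand: "[int (l r - 1) * ?F (int r) * int \<Lambda>
      = - int ((r - 1) * (l r - 1) * (\<Prod>x\<in>A - {r}. l x))] (mod int p)" if r: "r \<in> A" for r
  proof -
    have "\<Lambda> = l r * (\<Prod>x\<in>A - {r}. l x)" unfolding \<Lambda>_def using finA r by (rule prod.remove)
    then have "int (l r - 1) * ?F (int r) * int \<Lambda>
        = int (l r - 1) * int (\<Prod>x\<in>A - {r}. l x) * (int (l r) * ?F (int r))" by simp
    also have "[\<dots> = int (l r - 1) * int (\<Prod>x\<in>A - {r}. l x) * (- int (r - 1))] (mod int p)"
      using main[of r] r by (intro cong_mult cong_refl) (auto simp: A_def)
    finally show ?thesis by (simp add: mult_ac)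
  qed
  have "[- 1 * int \<Lambda> = 2 * ?F (int (s\<^sup>2)) * int \<Lambda>] (mod int p)"
    using half by (intro cong_mult cong_refl) (rule cong_sym)
  also have "[2 * ?F (int (s\<^sup>2)) * int \<Lambda> = 2 * (\<Sum>r\<in>A. int (l r - 1) * ?F (int r)) * int \<Lambda>] (mod int p)"
    using Fs by (intro cong_mult cong_refl)
  also have "2 * (\<Sum>r\<in>A. int (l r - 1) * ?F (int r)) * int \<Lambda>
      = 2 * (\<Sum>r\<in>A. int (l r - 1) * ?F (int r) * int \<Lambda>)"
    by (simp add: sum_distrib_right mult.assoc)
  also have "[\<dots> = 2 * (\<Sum>r\<in>A. - int ((r - 1) * (l r - 1) * (\<Prod>x\<in>A - {r}. l x)))] (mod int p)"
    by (intro cong_mult cong_refl cong_sum summand)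
  also have "2 * (\<Sum>r\<in>A. - int ((r - 1) * (l r - 1) * (\<Prod>x\<in>A - {r}. l x)))
      = - (2 * (\<Sum>r\<in>A. int ((r - 1) * (l r - 1) * (\<Prod>x\<in>A - {r}. l x))))"
    by (simp only: sum_negf mult_minus_right)
  finally have "int p dvd - (- 1 * int \<Lambda> - - (2 * (\<Sum>r\<in>A. int ((r - 1) * (l r - 1) * (\<Prod>x\<in>A - {r}. l x)))))"
    by (simp only: cong_iff_dvd_diff dvd_minus_iff)
  then show ?thesis unfolding cong_iff_dvd_diff \<Lambda>_def by (simp add: dvd_diff_commute)
qed

subsection \<open>Primorial and exponential estimates\<close>

lemma prod_primes_dvd:
  fixes n :: nat
  assumes "finite A" "\<And>q. q \<in> A \<Longrightarrow> prime q" "\<And>q. q \<in> A \<Longrightarrow> q dvd n"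
  shows "\<Prod>A dvd n"
  using assms
proof (induction A rule: finite_induct)
  case (insert x F)
  have "coprime x (\<Prod>F)"
    using insert by (intro prod_coprime_right) (auto intro: primes_coprime)
  then have "x * \<Prod>F dvd n" using insert by (intro divides_mult) auto
  then show ?case using insert by simp
qed simp

text \<open>Erdos's induction: for \<open>n = 2 * m + 1\<close>, the primes above
  \<open>m + 1\<close> divide the binomial coefficient \<open>2 * m + 1 choose m\<close>, which is
  at most \<open>4 ^ m\<close>; an even \<open>n > 2\<close> contributes no prime.\<close>

lemma primorial_le: "\<Prod>{q. prime q \<and> q \<le> n} \<le> 4 ^ (n::nat)"
proof (induction n rule: less_induct)
  case (less n)
  let ?P = "\<lambda>n::nat. {q::nat. prime q \<and> q \<le> n}"
  have fin: "finite (?P n)" for n by (rule finite_subset[of _ "{..n}"]) auto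
  consider "n < 2" | "n = 2" | "even n" "n > 2" | m where "n = 2 * m + 1" "m \<ge> 1"
  proof (cases "even n")
    case False
    then obtain m where "n = 2 * m + 1" by (elim oddE)
    then show thesis using that(1) that(4)[of m] by (cases "m \<ge> 1") auto
  qed (use that in force)
  then show ?case
  proof cases
    case 1
    then have "?P n = {}" by (auto dest: prime_ge_2_nat)
    then show ?thesis by (metis one_le_numeral one_le_power prod.empty)
  next
    case 2
    then have "?P n = {2}" by (auto dest: prime_ge_2_nat)
    then show ?thesis using 2 by simp
  next
    case 3
    have "q \<le> n \<longleftrightarrow> q \<le> n - 1" if "prime q" for q
    proof -
      have "q \<noteq> n" using prime_odd_nat[OF that] 3 by blast
      then show ?thesis using 3 by linarith
    qed
    then have "?P n = ?P (n - 1)" by blast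
    then have "\<Prod>(?P n) \<le> 4 ^ (n - 1)" using less[of "n - 1"] 3 by simp
    also have "\<dots> \<le> 4 ^ n" by (intro power_increasing) auto
    finally show ?thesis .
  next
    case (4 m)
    let ?Q = "{q::nat. prime q \<and> m + 1 < q \<and> q \<le> 2 * m + 1}"
    have finQ: "finite ?Q" by (rule finite_subset[OF _ fin[of "2 * m + 1"]]) auto
    have "q dvd (2 * m + 1 choose m)" if "q \<in> ?Q" for q
    proof -
      have q: "prime q" "m + 1 < q" "q \<le> 2 * m + 1" using that by auto
      have "fact m * fact (2 * m + 1 - m) * (2 * m + 1 choose m) = (fact (2 * m + 1) :: nat)"
        by (rule binomial_fact_lemma) simp
      moreover have "q dvd (fact (2 * m + 1) :: nat)"
        using q by (subst prime_dvd_fact_iff) auto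
      moreover have "\<not> q dvd (fact m :: nat)" "\<not> q dvd (fact (2 * m + 1 - m) :: nat)"
        using q by (subst prime_dvd_fact_iff; simp)+
      ultimately show ?thesis using q by (metis prime_dvd_mult_iff)
    qed
    then have "\<Prod>?Q dvd (2 * m + 1 choose m)"
      using finQ by (intro prod_primes_dvd) auto
    then have "\<Prod>?Q \<le> (2 * m + 1 choose m)" by (rule dvd_imp_le) simp
    \<comment> \<open>By symmetry the first half of row \<open>2 * m + 1\<close> sums to
      \<open>2 ^ (2 * m)\<close>.\<close>
    also have "\<dots> \<le> (\<Sum>k\<le>m. 2 * m + 1 choose k)" by (rule member_le_sum) auto
    also have "\<dots> = 4 ^ m" by (simp only: binomial_r_part_sum power_mult) simp
    finally have "\<Prod>?Q \<le> 4 ^ m" .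
    moreover have "\<Prod>(?P (m + 1)) \<le> 4 ^ (m + 1)" using 4 by (intro less) auto
    moreover have "?P n = ?P (m + 1) \<union> ?Q" using 4 by auto
    then have "\<Prod>(?P n) = \<Prod>(?P (m + 1)) * \<Prod>?Q"
      using fin[of "m + 1"] finQ by (simp only:) (rule prod.union_disjoint, auto)
    ultimately have "\<Prod>(?P n) \<le> 4 ^ (m + 1) * 4 ^ m" by (simp only: mult_le_mono)
    also have "\<dots> = 4 ^ n" using 4 by (simp only: power_add[symmetric]) (simp add: mult_2)
    finally show ?thesis .
  qed
qed

text \<open>Distinct odd numbers are at least 2 apart.\<close>

lemma odd_card_le_Max:
  fixes S :: "nat set"
  assumes "finite S" "\<And>x. x \<in> S \<Longrightarrow> odd x" "\<And>x. x \<in> S \<Longrightarrow> m \<le> x" "S \<noteq> {}" "odd m"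
  shows "m + 2 * (card S - 1) \<le> Max S"
proof -
  have "S \<subseteq> (\<lambda>i. m + 2 * i) ` {..(Max S - m) div 2}"
  proof
    fix x assume x: "x \<in> S"
    then have "even (x - m)" "x \<le> Max S" "m \<le> x" using assms by auto
    then have "x = m + 2 * ((x - m) div 2)" "(x - m) div 2 \<le> (Max S - m) div 2" by (auto intro: div_le_mono)
    then show "x \<in> (\<lambda>i. m + 2 * i) ` {..(Max S - m) div 2}" by blast
  qed
  then have "card S \<le> card {..(Max S - m) div 2}" by (rule surj_card_le[rotated]) simp
  moreover have "m \<le> Max S" using assms by simp
  ultimately show ?thesis by simp
qed

text \<open>The ratio \<open>((t + 1) / t) ^ e\<close> decreases in \<open>t\<close>, so checking it
  at \<open>k\<close> suffices.\<close>

lemma power_le_exponential_step: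
  assumes "(k + 1) ^ e \<le> c * k ^ e" "k \<le> (t::nat)" "k > 0"
  shows "(Suc t) ^ e \<le> c * t ^ e"
proof -
  have "(k * Suc t) ^ e \<le> ((k + 1) * t) ^ e" using assms by (intro power_mono) auto
  also have "\<dots> = (k + 1) ^ e * t ^ e" by (rule power_mult_distrib)
  also have "\<dots> \<le> c * k ^ e * t ^ e" using assms by (intro mult_le_mono) auto
  finally have "k ^ e * Suc t ^ e \<le> k ^ e * (c * t ^ e)" 
    by (simp only: power_mult_distrib mult_ac)
  then show ?thesis using assms(3) by (simp only: mult_le_cancel1 zero_less_power)
qed

text \<open>This bound and the next two serve the least exponents 3, 5 and 7, with \<open>t\<close>
  the number of the other bases. The constants fit the estimates made there; 125 is attained at
  \<open>t = 5\<close>.\<close>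

lemma square_le_exponential: "9 * t ^ 2 \<le> 4 * 5 ^ (t::nat)" if "t > 0"
  using that
proof (induction t rule: nat_induct_non_zero)
  case (Suc t)
  have "9 * (Suc t) ^ 2 \<le> 5 * (9 * t ^ 2)"
    using power_le_exponential_step[of 1 2 5 t] Suc.hyps by (simp add: numeral_2_eq_2[symmetric])
  then show ?case using Suc by simp
qed simp

lemma power6_le_exponential: "t ^ 6 \<le> 17 * 5 ^ (t::nat)"
proof (cases "t \<le> 4")
  case True
  then have "t \<in> {0, 1, 2, 3, 4}" by auto
  then show ?thesis by auto
next
  case False
  then have "4 \<le> t" by simp
  then show ?thesis
  proof (induction t rule: dec_induct)
    case (step t)
    have "Suc t ^ 6 \<le> 5 * t ^ 6" using step(1) by (intro power_le_exponential_step[of 4 6 5 t]) simp_all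
    then show ?case using step(3) unfolding power_Suc[of 5 t] by linarith
  qed simp
qed

lemma power8_le_exponential: "t ^ 8 \<le> 125 * 5 ^ (t::nat)"
proof (cases "t \<le> 5")
  case True
  then have "t \<in> {0, 1, 2, 3, 4, 5}" by auto
  then show ?thesis by auto
next
  case False
  then have "5 \<le> t" by simp
  then show ?thesis
  proof (induction t rule: dec_induct)
    case (step t)
    have "Suc t ^ 8 \<le> 5 * t ^ 8" using step(1) by (intro power_le_exponential_step[of 5 8 5 t]) simp_all
    then show ?case using step(3) unfolding power_Suc[of 5 t] by linarith
  qed simp
qed

text \<open>The factors 25 and 4 come from combining \<open>5 ^ (D - 1) < p\<close> with
  \<open>4 * p < 5 * r ^ e\<close> in \<open>exponents_less_base\<close>.\<close>

lemma power_le_exponential: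
  fixes k n e :: nat
  assumes "k > 0" "(k + 1) ^ e \<le> 5 * k ^ e" "25 * k ^ e \<le> 4 * 5 ^ k" "k \<le> n"
  shows "25 * n ^ e \<le> 4 * 5 ^ n"
  using assms(4)
proof (induction n rule: dec_induct)
  case (step n)
  have "Suc n ^ e \<le> 5 * n ^ e"
    using assms step(1) by (intro power_le_exponential_step[of k e 5 n]) auto
  then show ?case using step(3) unfolding power_Suc[of 5 n] by linarith
qed (use assms in auto)

subsection \<open>Primes that are repunits in several bases\<close>

text \<open>Here \<open>p\<close> is the repunit with \<open>l r\<close> digits in base \<open>r\<close>, for every \<open>r\<close> in \<open>A\<close>. Presumably \<open>A\<close> has
  at most one element (a case of the Goormaghtigh conjecture), but this is not known.\<close>

context
  fixes p :: nat and A :: "nat set" and l :: "nat \<Rightarrow> nat"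
  assumes p: "prime p" and finA: "finite A"
    and A: "\<And>r. r \<in> A \<Longrightarrow> prime r" "\<And>r. r \<in> A \<Longrightarrow> 5 \<le> r"
    and l_odd: "\<And>r. r \<in> A \<Longrightarrow> odd (l r)" and l_ge: "\<And>r. r \<in> A \<Longrightarrow> 3 \<le> l r"
    and eq: "\<And>r. r \<in> A \<Longrightarrow> (r - 1) * p + 1 = r ^ l r"
begin

lemma repunit_eq:
  assumes "r \<in> A"
  shows "p = (\<Sum>i<l r. r ^ i)"
proof -
  have r: "r \<ge> 5" and "l r \<ge> 3" using assms A l_ge by auto
  then obtain m where m: "l r = Suc m" by (cases "l r") auto
  have "(r - 1) * (\<Sum>i\<le>m. r ^ i) + 1 = (r - 1) * p + 1"
    using geometric_sum_nat[of r m] eq[OF assms] r m by (metis gr0I not_numeral_le_zero)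
  then have "(r - 1) * (\<Sum>i\<le>m. r ^ i) = (r - 1) * p" by simp
  then show ?thesis using r m by (simp add: lessThan_Suc_atMost)
qed

lemma power_less_repunit:
  assumes "r \<in> A"
  shows "r ^ (l r - 1) < p"
proof -
  have "(\<Sum>i\<in>{0, l r - 1}. r ^ i) \<le> (\<Sum>i<l r. r ^ i)"
    using l_ge[OF assms] by (intro sum_mono2) auto
  then show ?thesis using l_ge[OF assms] repunit_eq[OF assms] by simp
qed

text \<open>With \<open>power_less_repunit\<close> this locates \<open>p\<close> within a factor 5/4
  of \<open>r ^ (l r - 1)\<close>, for all bases at once.\<close>

lemma repunit_less_power:
  assumes "r \<in> A"
  shows "4 * p < 5 * r ^ (l r - 1)"
proof -
  have r: "r \<ge> 5" using assms A by auto
  obtain m where m: "l r = Suc m" using l_ge[OF assms] by (cases "l r") auto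
  have "(r - 1) * (4 * p) < 4 * r * r ^ m" using eq[OF assms] m by simp
  also have "\<dots> \<le> (5 * (r - 1)) * r ^ m" using r by (intro mult_le_mono1) simp
  finally show ?thesis using m by (simp add: mult.assoc[symmetric] mult.commute[of 5])
qed

text \<open>A proper divisor \<open>m > 1\<close> of \<open>l r\<close> would make the repunit with
  \<open>m\<close> digits a nontrivial divisor of \<open>p\<close>.\<close>

lemma exponent_prime:
  assumes r: "r \<in> A"
  shows "prime (l r)"
proof (rule ccontr)
  assume "\<not> prime (l r)"
  then obtain m where m: "m dvd l r" "m \<noteq> 1" "m \<noteq> l r"
    using l_ge[OF r] by (auto simp: prime_nat_iff)
  then obtain k where k: "l r = m * k" by auto
  have "m > 0" "m \<le> l r" using m(1) l_ge[OF r] by (auto intro!: Nat.gr0I dvd_imp_le)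
  then have mk: "l r = m * k" "1 < m" "m < l r" using k m by auto
  have r5: "r \<ge> 5" using A r by auto
  define G where "G = (\<Sum>i<m. r ^ i)"
  have G: "int (r - 1) * int G = int r ^ m - 1"
    using r5 power_diff_1_eq[of "int r" m] by (simp add: G_def of_nat_diff)
  have "int r ^ m - 1 dvd (int r ^ m) ^ k - 1" using power_diff_1_eq[of "int r ^ m" k] by simp
  also have "(int r ^ m) ^ k - 1 = int (r - 1) * int p"
  proof -
    have "int (r ^ l r) = int ((r - 1) * p + 1)" using eq[OF r] by simp
    then show ?thesis by (simp add: mk(1) power_mult)
  qed
  finally have "int G dvd int p" unfolding G[symmetric] using r5 by simp
  then have "G dvd p" by (simp add: of_nat_dvd_iff)
  moreover have "G > 1"
  proof -
    have "(\<Sum>i\<in>{0, 1}. r ^ i) \<le> G" unfolding G_def using mk by (intro sum_mono2) auto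
    then show ?thesis using r5 by simp
  qed
  moreover have "G < p"
    unfolding G_def repunit_eq[OF r] using mk r5
    by (intro sum_strict_mono2[where b = m]) auto
  ultimately show False using p by (metis nat_neq_iff prime_nat_iff)
qed

text \<open>For a fixed number of digits, the repunit grows strictly with the base.\<close>

lemma exponent_inj: "inj_on l A"
proof -
  have "\<not> r < r'" if "r \<in> A" "r' \<in> A" "l r = l r'" for r r'
  proof
    assume "r < r'"
    then have "(\<Sum>i<l r. r ^ i) < (\<Sum>i<l r. r' ^ i)"
      using l_ge[OF that(1)] by (intro sum_strict_mono_ex1) (auto intro!: power_mono bexI[of _ 1])
    then show False using repunit_eq[OF that(1)] repunit_eq[OF that(2)] that(3) by simp
  qed
  then show ?thesis by (intro inj_onI) (metis nat_neq_iff)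
qed

text \<open>Modulo \<open>l r\<close>, Fermat turns \<open>eq\<close> into
  \<open>(r - 1) * (p - 1) = 0\<close>. If \<open>l r\<close> divided \<open>r - 1\<close>, every
  power of \<open>r\<close> would be 1, so \<open>l r\<close> would divide the prime
  \<open>p\<close> and equal it, but \<open>l r\<close> is too small.\<close>

lemma exponent_dvd:
  assumes r: "r \<in> A"
  shows "l r dvd p - 1"
proof -
  have lp: "prime (l r)" by (rule exponent_prime[OF r])
  have r5: "r \<ge> 5" using A r by auto
  have ndvd: "\<not> l r dvd r - 1"
  proof
    assume "l r dvd r - 1"
    then have "[r = 1] (mod l r)" using r5 by (simp add: cong_altdef_nat)
    then have "[(\<Sum>i<l r. r ^ i) = (\<Sum>i<l r. 1 ^ i)] (mod l r)" by (intro cong_sum cong_pow)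
    then have "[p = l r] (mod l r)" using repunit_eq[OF r] by simp
    then have "l r dvd p" by (simp add: cong_def mod_eq_0_iff_dvd)
    then have "l r = p" using lp p by (simp add: primes_dvd_imp_eq)
    moreover have "l r - 1 < r ^ (l r - 1)" using r5
      by (intro less_exp[THEN less_le_trans] power_mono) auto
    ultimately show False using power_less_repunit[OF r] by simp
  qed
  have "[r ^ l r = r] (mod l r)"
  proof (cases "l r dvd r")
    case True
    then show ?thesis using dvd_trans[OF True dvd_power[of "l r" r]] l_ge[OF r]
      by (simp add: cong_def mod_eq_0_iff_dvd)
  next
    case False
    then have "[r * r ^ (l r - 1) = r * 1] (mod l r)"
      using lp by (intro cong_mult cong_refl fermat_theorem)
    then show ?thesis using l_ge[OF r] by (cases "l r") auto
  qed
  then have "[(r - 1) * p + 1 = r] (mod l r)" using eq[OF r] by simp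
  moreover have "(r - 1) * p + 1 = (r - 1) * (p - 1) + r"
    using prime_gt_0_nat[OF p] r5 by (cases r; cases p) auto
  ultimately have "[(r - 1) * (p - 1) + r = 0 + r] (mod l r)" by simp
  then have "l r dvd (r - 1) * (p - 1)" by (simp only: cong_add_rcancel_nat cong_0_iff)
  then show ?thesis using lp ndvd by (simp add: prime_dvd_mult_iff)
qed

lemma base_dvd:
  assumes r: "r \<in> A"
  shows "r dvd p - 1"
proof -
  obtain m where m: "l r = Suc m" using l_ge[OF r] by (cases "l r") auto
  have "p = 1 + r * (\<Sum>i<m. r ^ i)"
    using repunit_eq[OF r] unfolding m sum.lessThan_Suc_shift by (simp add: sum_distrib_left)
  then show ?thesis by simp
qed

text \<open>The exponents are distinct odd numbers and every base is at least 5, so many bases force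
  a large \<open>p\<close>.\<close>

lemma max_exponent:
  assumes "B \<subseteq> A" "B \<noteq> {}" "odd m" "\<And>r. r \<in> B \<Longrightarrow> m \<le> l r"
  shows "m + 2 * (card B - 1) \<le> Max (l ` B)" "5 ^ (Max (l ` B) - 1) < p"
proof -
  have fin: "finite B" using finA assms(1) by (rule finite_subset[rotated])
  have "card (l ` B) = card B" using inj_on_subset[OF exponent_inj assms(1)] by (rule card_image)
  then show "m + 2 * (card B - 1) \<le> Max (l ` B)"
    using odd_card_le_Max[of "l ` B" m] assms l_odd fin by auto
  have "Max (l ` B) \<in> l ` B" using fin assms by (intro Max_in) auto
  then obtain r where r: "r \<in> B" "l r = Max (l ` B)" by auto
  then have "5 ^ (l r - 1) \<le> r ^ (l r - 1)" using A assms(1) by (intro power_mono) auto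
  also have "\<dots> < p" using power_less_repunit[of r] r(1) assms(1) by blast
  finally show "5 ^ (Max (l ` B) - 1) < p" using r by simp
qed

lemma summand_le:
  assumes "r \<in> A"
  shows "(r - 1) * (l r - 1) * (\<Prod>x\<in>A - {r}. l x) \<le> (\<Prod>x\<in>A. l x) * (r - 1)"
proof -
  have "(l r - 1) * (\<Prod>x\<in>A - {r}. l x) \<le> l r * (\<Prod>x\<in>A - {r}. l x)"
    by (intro mult_le_mono1) simp
  also have "\<dots> = (\<Prod>x\<in>A. l x)" using finA assms by (rule prod.remove[symmetric])
  finally show ?thesis by (simp add: mult_le_mono2 mult.assoc mult.commute[of "r - 1"])
qed

text \<open>One summand suffices, since \<open>r - 1 \<ge> 4\<close>. This keeps the congruence
  between the two sides from holding as an equality.\<close>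

lemma weighted_sum_greater:
  assumes "A \<noteq> {}"
  shows "(\<Prod>x\<in>A. l x) < 2 * (\<Sum>r\<in>A. (r - 1) * (l r - 1) * (\<Prod>x\<in>A - {r}. l x))"
proof -
  obtain r where r: "r \<in> A" using assms by auto
  let ?c = "\<Prod>x\<in>A - {r}. l x"
  have c: "?c > 0" using l_ge by (intro prod_pos) force
  have "l r < 2 * (4 * (l r - 1))" using l_ge[OF r] by linarith
  also have "\<dots> \<le> 2 * ((r - 1) * (l r - 1))" using A(2)[OF r] by (intro mult_le_mono) auto
  finally have "l r * ?c < 2 * ((r - 1) * (l r - 1)) * ?c" using c by (rule mult_less_mono1)
  also have "\<dots> \<le> 2 * (\<Sum>r\<in>A. (r - 1) * (l r - 1) * (\<Prod>x\<in>A - {r}. l x))"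
    using member_le_sum[OF r, of "\<lambda>r. (r - 1) * (l r - 1) * (\<Prod>x\<in>A - {r}. l x)"] finA by simp
  also have "l r * ?c = (\<Prod>x\<in>A. l x)" using finA r by (rule prod.remove[symmetric])
  finally show ?thesis .
qed

lemma weighted_sum_less_singleton:
  assumes r: "r \<in> A"
  shows "2 * ((r - 1) * (l r - 1)) < p"
proof -
  have r5: "r \<ge> 5" using A r by auto
  \<comment> \<open>With \<open>l r = n + 3\<close> this is
    \<open>2 * (l r - 1) \<le> r ^ (l r - 2)\<close>.\<close>
  have *: "2 * (n + 2) \<le> r ^ Suc n" for n
  proof (induction n)
    case (Suc n)
    have "2 * (Suc n + 2) \<le> 5 * (2 * (n + 2))" by simp
    also have "\<dots> \<le> r * r ^ Suc n" using Suc r5 by (intro mult_le_mono) auto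
    finally show ?case by simp
  qed (use r5 in auto)
  obtain n where n: "l r = Suc (Suc (Suc n))"
    using l_ge[OF r] by (metis Suc_le_D numeral_3_eq_3 Suc_le_mono)
  have "2 * ((r - 1) * (l r - 1)) = (r - 1) * (2 * (n + 2))" using n by simp
  also have "\<dots> \<le> (r - 1) * r ^ Suc n" using * by (rule mult_le_mono2)
  also have "\<dots> \<le> r * r ^ Suc n" by (rule mult_le_mono1) simp
  also have "\<dots> = r ^ (l r - 1)" using n by simp
  also have "\<dots> < p" using power_less_repunit[OF r] .
  finally show ?thesis .
qed

text \<open>With all exponents at least 11 the crude estimates \<open>210 * \<Lambda> \<le> 4 ^ D\<close> (primorial bound),
  \<open>r < p powr (1/10)\<close> and \<open>5 ^ (D - 1) < p\<close> suffice, because \<open>4 < 5 powr (9/10)\<close>.\<close>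

lemma weighted_sum_less_large:
  assumes ne: "A \<noteq> {}" and ge: "\<And>r. r \<in> A \<Longrightarrow> 11 \<le> l r"
  shows "2 * ((\<Prod>x\<in>A. l x) * (\<Sum>r\<in>A. r - 1)) < p"
proof -
  define x where "x = Max (l ` A) - 1"
  define \<Lambda> where "\<Lambda> = (\<Prod>x\<in>A. l x)"
  have m: "11 + 2 * (card A - 1) \<le> Max (l ` A)" "5 ^ x < p"
    using max_exponent[of A 11] ne ge unfolding x_def by auto
  have card: "2 * card A \<le> x" using m(1) unfolding x_def by simp
  \<comment> \<open>210 is the product of 2, 3, 5 and 7, which are no exponents here but occur in
    the primorial.\<close>
  have "210 * \<Lambda> \<le> 4 ^ (x + 1)"
  proof -
    let ?P = "{q. prime q \<and> q \<le> x + 1}"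
    have "\<Lambda> = \<Prod>(l ` A)" unfolding \<Lambda>_def using exponent_inj by (simp add: prod.reindex)
    moreover have "{2, 3, 5, 7} \<inter> l ` A = {}" using ge by fastforce
    ultimately have "210 * \<Lambda> = \<Prod>({2, 3, 5, 7} \<union> l ` A)"
      using finA by (subst prod.union_disjoint) auto
    also have "\<dots> dvd \<Prod>?P"
    proof (rule prod_dvd_prod_subset)
      have "l r \<le> x + 1" if "r \<in> A" for r
      proof -
        have "l r \<le> Max (l ` A)" using finA that by simp
        then show ?thesis unfolding x_def by linarith
      qed
      moreover have "11 \<le> x + 1" using m(1) unfolding x_def by simp
      ultimately show "{2, 3, 5, 7} \<union> l ` A \<subseteq> ?P" using exponent_prime by auto
    qed (auto intro: finite_subset[of _ "{..x + 1}"])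
    finally have "210 * \<Lambda> dvd \<Prod>?P" .
    moreover have "\<Prod>?P > 0" by (intro prod_pos) (auto simp: prime_gt_0_nat)
    ultimately have "210 * \<Lambda> \<le> \<Prod>?P" by (rule dvd_imp_le)
    also have "\<dots> \<le> 4 ^ (x + 1)" by (rule primorial_le)
    finally show ?thesis .
  qed
  define K where "K = 2 * card A * \<Lambda>"
  \<comment> \<open>Passing from 16 to 17 absorbs the linear factor, and
    \<open>17 ^ 10 \<le> 4 ^ 10 * 5 ^ 9\<close> still holds.\<close>
  have bern: "4 * x * 16 ^ x \<le> 210 * 17 ^ x" for x :: nat
  proof (induction x)
    case (Suc x)
    have "(16::nat) ^ x \<le> 17 ^ x" by (rule power_mono) auto
    then have "16 * (4 * x * 16 ^ x) + 64 * 16 ^ x \<le> 16 * (210 * 17 ^ x) + 210 * (17 ^ x :: nat)"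
      using Suc by linarith
    moreover have "16 * (4 * x * 16 ^ x) + 64 * 16 ^ x = 4 * Suc x * 16 ^ Suc x"
      by (simp add: algebra_simps)
    ultimately show ?case by simp
  qed simp
  have "210 * (K * 4 ^ x) \<le> 210 * 17 ^ x"
  proof -
    have "210 * (K * 4 ^ x) = 2 * card A * (210 * \<Lambda>) * 4 ^ x" unfolding K_def by simp
    also have "\<dots> \<le> x * 4 ^ (x + 1) * 4 ^ x"
      using card \<open>210 * \<Lambda> \<le> 4 ^ (x + 1)\<close> by (intro mult_le_mono) auto
    also have "\<dots> = 4 * x * (4 * 4) ^ x" by (simp only: power_mult_distrib) simp
    also have "\<dots> \<le> 210 * 17 ^ x" using bern[of x] by simp
    finally show ?thesis .
  qed
  then have "(K * 4 ^ x) ^ 10 \<le> (17 ^ x) ^ 10" by (intro power_mono) auto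
  also have "(17 ^ x) ^ 10 = (17 ^ 10 :: nat) ^ x" by (simp only: power_mult[symmetric] mult.commute)
  also have "\<dots> \<le> (4 ^ 10 * 5 ^ 9) ^ x" by (intro power_mono) auto
  also have "\<dots> = (4 ^ x) ^ 10 * (5 ^ x) ^ 9"
    by (simp only: power_mult_distrib power_mult[symmetric] mult.commute)
  finally have K: "K ^ 10 \<le> (5 ^ x) ^ 9" by (simp only: power_mult_distrib) (simp add: mult.commute)
  define R where "R = Max A"
  have RA: "R \<in> A" unfolding R_def using finA ne by (rule Max_in)
  have "R ^ 10 \<le> R ^ (l R - 1)"
  proof (rule power_increasing)
    show "10 \<le> l R - 1" using ge[OF RA] by simp
    show "1 \<le> R" using A(2)[OF RA] by simp
  qed
  then have R: "R ^ 10 < p" using power_less_repunit[OF RA] by simp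
  \<comment> \<open>Tenth powers replace real exponents: \<open>K\<close> is at most
    \<open>p powr (9/10)\<close> and \<open>R\<close> is below \<open>p powr (1/10)\<close>.\<close>
  have "(K * R) ^ 10 < p ^ 10"
  proof -
    have "(K * R) ^ 10 = K ^ 10 * R ^ 10" by (rule power_mult_distrib)
    also have "\<dots> \<le> (5 ^ x) ^ 9 * R ^ 10" using K by (rule mult_le_mono1)
    also have "\<dots> \<le> p ^ 9 * R ^ 10" using m(2) by (intro mult_le_mono1 power_mono) auto
    also have "\<dots> < p ^ 9 * p" using R p by (simp add: prime_gt_0_nat)
    finally show ?thesis by (simp add: power_Suc2[symmetric] del: power_Suc)
  qed
  then have KR: "K * R < p" by (rule power_less_imp_less_base) simp
  have "(\<Sum>r\<in>A. r - 1) \<le> (\<Sum>r\<in>A. R)"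
    using finA unfolding R_def by (intro sum_mono) (meson Max_ge diff_le_self le_trans)
  then have "2 * (\<Lambda> * (\<Sum>r\<in>A. r - 1)) \<le> 2 * (\<Lambda> * (card A * R))" by simp
  also have "\<dots> = K * R" unfolding K_def by simp
  finally show ?thesis using KR unfolding \<Lambda>_def by simp
qed

text \<open>\<open>r\<close> and the exponents are distinct primes dividing \<open>p - 1\<close>,
  and \<open>k\<close> is a divisor coprime to all of them, so the whole product divides
  \<open>p - 1\<close>.\<close>

lemma times_prod_exponents_le:
  assumes r: "r \<in> A" and max: "\<And>x. x \<in> A \<Longrightarrow> l x < r"
    and k: "k dvd p - 1" "coprime k r" "\<And>x. x \<in> A \<Longrightarrow> coprime k (l x)"
  shows "k * r * (\<Prod>x\<in>A. l x) < p"
proof -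
  have "\<Prod>(insert r (l ` A)) dvd p - 1"
    using r finA A exponent_prime exponent_dvd base_dvd by (intro prod_primes_dvd) auto
  moreover have "\<Prod>(insert r (l ` A)) = r * (\<Prod>x\<in>A. l x)"
  proof -
    have "r \<notin> l ` A" using max by fastforce
    then show ?thesis using finA exponent_inj by (simp add: prod.reindex)
  qed
  moreover have "coprime k (r * (\<Prod>x\<in>A. l x))"
    using k by (simp add: prod_coprime_right)
  ultimately have "k * (r * (\<Prod>x\<in>A. l x)) dvd p - 1"
    by (metis divides_mult k(1))
  then have "k * (r * (\<Prod>x\<in>A. l x)) \<le> p - 1"
    using prime_gt_1_nat[OF p] by (intro dvd_imp_le) auto
  then show ?thesis using prime_gt_0_nat[OF p] by (simp add: mult.assoc)
qed

text \<open>Otherwise \<open>r\<close> is at most the largest exponent \<open>D\<close>, and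
  \<open>5 ^ (D - 1) < p\<close> stays below 5/4 of \<open>D ^ e\<close>, which is impossible from
  \<open>k\<close> on.\<close>

lemma exponents_less_base:
  assumes r: "r \<in> A" and e: "l r = Suc e"
    and k: "k > 0" "(k + 1) ^ e \<le> 5 * k ^ e" "25 * k ^ e \<le> 4 * 5 ^ k"
    and D: "k \<le> Max (l ` A)" and x: "x \<in> A"
  shows "l x < r"
proof (rule ccontr)
  let ?D = "Max (l ` A)"
  assume "\<not> l x < r"
  moreover have "l x \<le> ?D" using finA x by simp
  ultimately have "r \<le> ?D" by simp
  have "25 * ?D ^ e \<le> 4 * 5 ^ ?D"
    using k D by (rule power_le_exponential)
  moreover have "4 * 5 ^ ?D < 25 * ?D ^ e"
  proof -
    have "?D > 0" using D k by simp
    then have "4 * 5 ^ ?D = (20 * 5 ^ (?D - 1) :: nat)" by (cases ?D) auto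
    also have "\<dots> < 20 * p" using max_exponent(2)[of A 1] r l_ge by force
    also have "\<dots> < 25 * r ^ e" using repunit_less_power[OF r] e by simp
    also have "\<dots> \<le> 25 * ?D ^ e" using \<open>r \<le> ?D\<close> by (intro mult_le_mono power_mono) auto
    finally show ?thesis .
  qed
  ultimately show False by simp
qed

text \<open>Exponents larger by \<open>d\<close> force smaller bases: the largest other base
  \<open>R\<close> has \<open>R ^ (e + d) < p\<close> and \<open>4 * p < 5 * r ^ e\<close>. The
  hypothesis \<open>le\<close> makes room for \<open>c\<close> and the number of summands.\<close>

lemma sum_others_le:
  assumes r: "r \<in> A" and e: "l r = Suc e" and m: "\<And>x. x \<in> A - {r} \<Longrightarrow> e + d + 1 \<le> l x"
    and d: "d > 0" and le: "5 * (c * card (A - {r})) ^ (e + d) \<le> 4 * r ^ d"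
  shows "c * (\<Sum>x\<in>A - {r}. x - 1) \<le> r"
proof (cases "A - {r} = {}")
  case False
  define R where "R = Max (A - {r})"
  let ?t = "card (A - {r})"
  have R: "R \<in> A - {r}" unfolding R_def using finA False by (intro Max_in) auto
  have "R ^ (e + d) \<le> R ^ (l R - 1)"
  proof (rule power_increasing)
    show "e + d \<le> l R - 1" using m[OF R] by simp
    show "1 \<le> R" using A(2)[of R] R by simp
  qed
  also have "\<dots> < p" using power_less_repunit R by auto
  finally have Rp: "R ^ (e + d) \<le> p" by simp
  have "4 * (c * ?t * R) ^ (e + d) = (c * ?t) ^ (e + d) * (4 * R ^ (e + d))"
    by (simp only: power_mult_distrib mult_ac)
  also have "\<dots> \<le> (c * ?t) ^ (e + d) * (5 * r ^ e)"
    using Rp repunit_less_power[OF r] e by (intro mult_le_mono2) simp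
  also have "\<dots> = 5 * (c * ?t) ^ (e + d) * r ^ e" by simp
  also have "\<dots> \<le> 4 * r ^ d * r ^ e" using le by (rule mult_le_mono1)
  finally have "(c * ?t * R) ^ (e + d) \<le> r ^ (e + d)" by (simp add: power_add mult_ac)
  then have "c * ?t * R \<le> r" using d by (subst (asm) power_mono_iff) auto
  moreover have "(\<Sum>x\<in>A - {r}. x - 1) \<le> (\<Sum>x\<in>A - {r}. R)"
    using finA unfolding R_def by (intro sum_mono) (meson Max_ge diff_le_self le_trans finite_Diff)
  then have "c * (\<Sum>x\<in>A - {r}. x - 1) \<le> c * (?t * R)" by simp
  ultimately show ?thesis by (simp only: mult.assoc)
next
  case True
  then show ?thesis by (simp only: sum.empty)
qed

text \<open>Turns the bound of \<open>max_exponent\<close> on \<open>p\<close> into one on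
  \<open>r\<close>; with \<open>t\<close> other bases, \<open>f + 2 * t\<close> is
  \<open>m + 2 * (t - 1) - 1\<close>.\<close>

lemma base_power_greater:
  assumes r: "r \<in> A" and e: "l r = Suc e" and B: "A - {r} \<noteq> {}" "odd m"
    and m: "\<And>x. x \<in> A - {r} \<Longrightarrow> m \<le> l x" and t: "m - 3 = f" "3 \<le> m"
  shows "4 * (5 ^ f * 5 ^ (2 * card (A - {r}))) < 5 * r ^ e" "m \<le> Max (l ` A)"
proof -
  let ?B = "A - {r}" and ?t = "card (A - {r})"
  have D: "m + 2 * (?t - 1) \<le> Max (l ` ?B)" "5 ^ (Max (l ` ?B) - 1) < p"
    using max_exponent[of ?B m] B m by auto
  have "?t > 0" using B finA by (simp add: card_gt_0_iff)
  then have "f + 2 * ?t \<le> Max (l ` ?B) - 1" using D(1) t by linarith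
  then have "(5::nat) ^ (f + 2 * ?t) \<le> 5 ^ (Max (l ` ?B) - 1)" by (rule power_increasing) simp
  also have "\<dots> < p" by (rule D(2))
  finally have "4 * 5 ^ (f + 2 * ?t) < 5 * r ^ e" using repunit_less_power[OF r] e by simp
  then show "4 * (5 ^ f * 5 ^ (2 * ?t)) < 5 * r ^ e" by (simp add: power_add)
  have "Max (l ` ?B) \<le> Max (l ` A)" using finA B by (intro Max_mono) auto
  then show "m \<le> Max (l ` A)" using D(1) by linarith
qed

text \<open>When 3 is the least exponent, \<open>p - 1 = r * (r + 1)\<close> for its base \<open>r\<close>, which is larger than all
  exponents and, by size, larger than three times the sum of the other bases. Divisibility then bounds
  the product of the exponents. For 5 and 7 the argument is the same, where the extra factor 4 or 6 of
  \<open>p - 1\<close> compensates for the weaker separation of the bases.\<close>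

lemma weighted_sum_less_3:
  assumes r: "r \<in> A" "l r = 3" and B: "A - {r} \<noteq> {}"
  shows "2 * (\<Sum>r\<in>A. (r - 1) * (l r - 1) * (\<Prod>x\<in>A - {r}. l x)) < p"
proof -
  let ?\<Lambda> = "\<Prod>x\<in>A. l x" and ?t = "card (A - {r})"
  let ?w = "\<lambda>r. (r - 1) * (l r - 1) * (\<Prod>x\<in>A - {r}. l x)"
  have e: "l r = Suc 2" using r by simp
  have t: "?t > 0" using B finA by (simp add: card_gt_0_iff)
  have l5: "5 \<le> l x" if "x \<in> A - {r}" for x
  proof -
    have "l x \<noteq> 3" using that r exponent_inj by (metis DiffD1 DiffD2 inj_onD singletonI)
    then have "l x \<noteq> 3" "l x \<noteq> 4" "3 \<le> l x" using l_odd[of x] l_ge[of x] that by auto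
    then show ?thesis by linarith
  qed
  have big: "4 * (5 ^ 2 * 5 ^ (2 * ?t)) < 5 * r\<^sup>2" "5 \<le> Max (l ` A)"
    using base_power_greater[OF r(1) e B, of 5 2] l5 by auto
  have less: "l x < r" if "x \<in> A" for x
    using exponents_less_base[OF r(1) e, of 5] big(2) that by simp
  \<comment> \<open>Squaring gives \<open>81 * ?t ^ 4 \<le> 16 * 5 ^ (2 * ?t)\<close>, while
    \<open>big\<close> says \<open>20 * 5 ^ (2 * ?t) < r\<^sup>2\<close>.\<close>
  have "9 * ?t\<^sup>2 \<le> 4 * 5 ^ ?t" using t by (rule square_le_exponential)
  then have "(9 * ?t\<^sup>2)\<^sup>2 \<le> (4 * 5 ^ ?t)\<^sup>2" by (rule power_mono) simp
  then have "5 * (3 * ?t) ^ (2 + 2) \<le> 4 * r\<^sup>2"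
    using big(1) by (simp add: power_mult_distrib power_mult[symmetric] mult.commute[of 2])
  then have S: "3 * (\<Sum>x\<in>A - {r}. x - 1) \<le> r"
    using l5 by (intro sum_others_le[OF r(1) e, of 2]) auto
  have "2 * r * ?\<Lambda> < p"
  proof (rule times_prod_exponents_le[OF r(1) less])
    have "odd p" using prime_odd_nat[OF p] power_less_repunit[OF r(1)] power_mono[of 5 r 2] A(2)[OF r(1)] r(2) by simp
    then show "2 dvd p - 1" by simp
    show "coprime 2 r" using prime_odd_nat[of r] A[OF r(1)] by simp
    show "coprime 2 (l x)" if "x \<in> A" for x using l_odd[OF that] by simp
  qed
  \<comment> \<open>For exponent 3 the summand of \<open>r\<close> is exactly 2/3 of
    \<open>(r - 1) * ?\<Lambda>\<close>, leaving 1/3 of \<open>?\<Lambda> * r\<close> for the other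
    bases.\<close>
  have "3 * ?w r = 2 * ((r - 1) * ?\<Lambda>)"
  proof -
    have "?\<Lambda> = l r * (\<Prod>x\<in>A - {r}. l x)" using finA r(1) by (rule prod.remove)
    then show ?thesis using r(2) by simp
  qed
  moreover have "(\<Sum>x\<in>A - {r}. ?w x) \<le> (\<Sum>x\<in>A - {r}. ?\<Lambda> * (x - 1))"
    by (intro sum_mono summand_le) auto
  then have "3 * (\<Sum>x\<in>A - {r}. ?w x) \<le> 3 * (\<Sum>x\<in>A - {r}. ?\<Lambda> * (x - 1))"
    by (rule mult_le_mono2)
  then have "3 * (\<Sum>x\<in>A - {r}. ?w x) \<le> ?\<Lambda> * (3 * (\<Sum>x\<in>A - {r}. x - 1))"
    by (simp only: sum_distrib_left[symmetric] mult.left_commute)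
  then have "3 * (\<Sum>x\<in>A - {r}. ?w x) \<le> ?\<Lambda> * r"
    using S by (meson le_trans mult_le_mono2)
  moreover have "(\<Sum>x\<in>A. ?w x) = ?w r + (\<Sum>x\<in>A - {r}. ?w x)"
    using finA r(1) by (rule sum.remove)
  moreover have "(r - 1) * ?\<Lambda> \<le> ?\<Lambda> * r" by (simp add: mult.commute)
  ultimately have "3 * (2 * (\<Sum>x\<in>A. ?w x)) \<le> 6 * (?\<Lambda> * r)" by linarith
  then have "2 * (\<Sum>x\<in>A. ?w x) \<le> 2 * (?\<Lambda> * r)" by linarith
  also have "\<dots> < p" using \<open>2 * r * ?\<Lambda> < p\<close> by (simp add: mult_ac)
  finally show ?thesis .
qed

text \<open>Rounding \<open>l r - 1\<close> up to \<open>l r\<close> is a loss affordable once the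
  least exponent is at least 5.\<close>

lemma weighted_sum_le:
  "(\<Sum>r\<in>A. (r - 1) * (l r - 1) * (\<Prod>x\<in>A - {r}. l x)) \<le> (\<Prod>x\<in>A. l x) * (\<Sum>r\<in>A. r - 1)"
  unfolding sum_distrib_left by (intro sum_mono summand_le)

lemma weighted_sum_less_5_7:
  assumes r: "r \<in> A" "l r = 5 \<or> l r = 7" and min: "\<And>x. x \<in> A \<Longrightarrow> l r \<le> l x" and B: "A - {r} \<noteq> {}"
  shows "2 * ((\<Prod>x\<in>A. l x) * (\<Sum>r\<in>A. r - 1)) < p"
proof -
  let ?\<Lambda> = "\<Prod>x\<in>A. l x" and ?t = "card (A - {r})"
  have odd_r: "odd r" using prime_odd_nat[of r] A[OF r(1)] by simp
  have repunit: "p - 1 = (\<Sum>i<l r - 1. r ^ Suc i)"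
    using repunit_eq[OF r(1)] l_ge[OF r(1)] by (cases "l r") (auto simp: sum.lessThan_Suc_shift simp del: sum.lessThan_Suc)
  have ne: "l x \<noteq> l r" if "x \<in> A - {r}" for x
    using that r exponent_inj by (metis DiffD1 DiffD2 inj_onD singletonI)
  \<comment> \<open>The factor 4 is what is needed: the sum over all of \<open>A\<close> is at most
    \<open>2 * r\<close>, and it is doubled.\<close>
  have "(\<Sum>x\<in>A - {r}. x - 1) \<le> r \<and> 4 * r * ?\<Lambda> < p"
    using r(2)
  proof
    assume l: "l r = 5"
    have e: "l r = Suc 4" using l by simp
    have l7: "7 \<le> l x" if "x \<in> A - {r}" for x
    proof -
      have "l x \<noteq> 5" "l x \<noteq> 6" "5 \<le> l x" using ne[OF that] min[of x] l_odd[of x] l that by auto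
      then show ?thesis by linarith
    qed
    have big: "4 * (5 ^ 4 * 5 ^ (2 * ?t)) < 5 * r ^ 4" "7 \<le> Max (l ` A)"
      using base_power_greater[OF r(1) e B, of 7 4] l7 by auto
    have less: "l x < r" if "x \<in> A" for x
      using exponents_less_base[OF r(1) e, of 7] big(2) that by simp
    \<comment> \<open>\<open>big\<close> amounts to \<open>500 * 5 ^ (2 * ?t) < r ^ 4\<close>, and
      \<open>7225 \<le> 16 * 500\<close>.\<close>
    have "(5 * ?t ^ 6)\<^sup>2 \<le> (5 * (17 * 5 ^ ?t))\<^sup>2"
      using power6_le_exponential[of ?t] by (intro power_mono mult_le_mono2) auto
    also have "\<dots> = 7225 * 5 ^ (2 * ?t)"
      by (simp add: power_mult_distrib power_mult[symmetric] mult.commute[of 2])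
    also have "\<dots> \<le> 16 * r ^ 4" using big(1) by simp
    also have "\<dots> = (4 * r\<^sup>2)\<^sup>2" by (simp add: power_mult_distrib power_mult[symmetric])
    finally have "5 * (1 * ?t) ^ (4 + 2) \<le> 4 * r\<^sup>2" by (subst (asm) power_mono_iff) auto
    then have "1 * (\<Sum>x\<in>A - {r}. x - 1) \<le> r"
      using l7 by (intro sum_others_le[OF r(1) e, of 2]) auto
    moreover have "4 * r * ?\<Lambda> < p"
    proof (rule times_prod_exponents_le[OF r(1) less])
      have "p - 1 = r * ((1 + r) * (1 + r * r))"
        unfolding repunit using l by (simp add: eval_nat_numeral algebra_simps)
      moreover have "2 * 2 dvd (1 + r) * (1 + r * r)" using odd_r by (intro mult_dvd_mono) auto
      ultimately have "2 * 2 dvd p - 1" by (metis dvd_mult)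
      then show "4 dvd p - 1" by simp
      have "coprime (2 ^ 2) m" if "odd m" for m :: nat
        using that by (simp only: coprime_power_left_iff coprime_left_2_iff_odd) simp
      then have four: "coprime 4 m" if "odd m" for m :: nat using that by simp
      then show "coprime 4 r" using odd_r .
      show "coprime 4 (l x)" if "x \<in> A" for x using four l_odd[OF that] by simp
    qed
    ultimately show ?thesis by simp
  next
    assume l: "l r = 7"
    have e: "l r = Suc 6" using l by simp
    have l11: "11 \<le> l x" if "x \<in> A - {r}" for x
    proof -
      have "odd (l x)" "7 \<le> l x" "l x \<noteq> 7" using ne[OF that] min[of x] l_odd[of x] l that by auto
      moreover have "l x \<noteq> 9" using exponent_prime[of x] that by auto
      moreover have "l x \<noteq> 8" "l x \<noteq> 10" using \<open>odd (l x)\<close> by auto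
      ultimately show ?thesis by linarith
    qed
    have big: "4 * (5 ^ 8 * 5 ^ (2 * ?t)) < 5 * r ^ 6" "11 \<le> Max (l ` A)"
      using base_power_greater[OF r(1) e B, of 11 8] l11 by auto
    have less: "l x < r" if "x \<in> A" for x
      using exponents_less_base[OF r(1) e, of 11] big(2) that by simp
    have "?t > 0" using B finA by (simp add: card_gt_0_iff)
    \<comment> \<open>Cubing produces \<open>r ^ 12\<close>, the square of the power bounded by
      \<open>big\<close>; raising \<open>?t ^ 30\<close> to \<open>?t ^ 32\<close> makes it a power
      of \<open>?t ^ 8\<close>.\<close>
    have "(5 * ?t ^ 10) ^ 3 \<le> 64 * r ^ 12"
    proof -
      have "(5 * ?t ^ 10) ^ 3 = 125 * ?t ^ 30" by (simp add: power_mult_distrib power_mult[symmetric])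
      also have "\<dots> \<le> 125 * ?t ^ 32" using \<open>?t > 0\<close> by (intro mult_le_mono2 power_increasing) auto
      also have "\<dots> = 125 * (?t ^ 8) ^ 4" by (simp add: power_mult[symmetric])
      also have "\<dots> \<le> 125 * (125 * 5 ^ ?t) ^ 4"
        using power8_le_exponential[of ?t] by (intro mult_le_mono2 power_mono) auto
      also have "\<dots> = 125 * 125 ^ 4 * (5 ^ (2 * ?t))\<^sup>2"
        by (simp add: power_mult_distrib power_mult[symmetric] mult.commute)
      also have "\<dots> \<le> 64 * (312500 * 5 ^ (2 * ?t))\<^sup>2" by (simp add: power_mult_distrib)
      also have "\<dots> \<le> 64 * (r ^ 6)\<^sup>2" using big(1) by (intro mult_le_mono2 power_mono) auto
      also have "\<dots> = 64 * r ^ 12" by (simp add: power_mult[symmetric])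
      finally show ?thesis by simp
    qed
    also have "\<dots> = (4 * r ^ 4) ^ 3" by (simp add: power_mult_distrib power_mult[symmetric])
    finally have "5 * (1 * ?t) ^ (6 + 4) \<le> 4 * r ^ 4" by (subst (asm) power_mono_iff) auto
    then have "1 * (\<Sum>x\<in>A - {r}. x - 1) \<le> r"
      using l11 by (intro sum_others_le[OF r(1) e, of 4]) auto
    moreover have "6 * r * ?\<Lambda> < p"
    proof (rule times_prod_exponents_le[OF r(1) less])
      have *: "p - 1 = r * ((1 + r) * (1 + r\<^sup>2 + r ^ 4))"
        unfolding repunit using l by (simp add: eval_nat_numeral algebra_simps)
      have "2 dvd p - 1" unfolding * using odd_r by simp
      \<comment> \<open>\<open>r\<close>, \<open>1 + r\<close> or
        \<open>1 + r\<^sup>2 + r ^ 4\<close> is divisible by 3 according as \<open>r\<close> is 0, 2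
        or 1 modulo 3.\<close>
      moreover have "3 dvd p - 1"
      proof -
        define c where "c = r mod 3"
        have "[r = c] (mod 3)" by (simp add: c_def)
        then have "[p - 1 = c * ((1 + c) * (1 + c\<^sup>2 + c ^ 4))] (mod 3)"
          unfolding * by (intro cong_mult cong_add cong_pow cong_refl)
        moreover have "c = 0 \<or> c = 1 \<or> c = 2" unfolding c_def by auto
        then have "[c * ((1 + c) * (1 + c\<^sup>2 + c ^ 4)) = 0] (mod 3)" by (auto simp: cong_def)
        ultimately have "[p - 1 = 0] (mod 3)" by (rule cong_trans)
        then show ?thesis by (simp only: cong_0_iff)
      qed
      ultimately have "2 * 3 dvd p - 1" by (intro divides_mult) (auto intro: primes_coprime)
      then show "6 dvd p - 1" by simp
      have six: "coprime 6 m" if "prime m" "5 \<le> m" for m :: nat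
      proof -
        have "coprime (2 * 3) m"
          unfolding coprime_mult_left_iff using that primes_coprime[of 2 m] primes_coprime[of 3 m] by simp
        then show ?thesis by simp
      qed
      then show "coprime 6 r" using A[OF r(1)] by simp
      show "coprime 6 (l x)" if "x \<in> A" for x
        using six[OF exponent_prime[OF that]] min[OF that] l by simp
    qed
    ultimately show ?thesis by simp
  qed
  then have S: "(\<Sum>x\<in>A - {r}. x - 1) \<le> r" and \<Lambda>: "4 * r * ?\<Lambda> < p" by auto
  have "(\<Sum>x\<in>A. x - 1) = (r - 1) + (\<Sum>x\<in>A - {r}. x - 1)"
    using finA r(1) by (rule sum.remove)
  then have "(\<Sum>x\<in>A. x - 1) \<le> 2 * r" using S by simp
  then have "2 * (?\<Lambda> * (\<Sum>x\<in>A. x - 1)) \<le> 2 * (?\<Lambda> * (2 * r))"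
    by (intro mult_le_mono2)
  also have "\<dots> < p" using \<Lambda> by (simp add: mult_ac)
  finally show ?thesis .
qed

text \<open>The least exponent is an odd prime, hence 3, 5, 7 or at least 11. A single base is
  treated apart because the cases 3, 5 and 7 need a second one.\<close>

lemma weighted_sum_less:
  assumes ne: "A \<noteq> {}"
  shows "2 * (\<Sum>r\<in>A. (r - 1) * (l r - 1) * (\<Prod>x\<in>A - {r}. l x)) < p"
proof -
  have "Min (l ` A) \<in> l ` A" using finA ne by (intro Min_in) auto
  then obtain r where r: "r \<in> A" "l r = Min (l ` A)" by auto
  then have min: "l r \<le> l x" if "x \<in> A" for x using finA that by simp
  show ?thesis
  proof (cases "A - {r} = {}")
    case True
    then have "A = {r}" using r by auto
    then show ?thesis using weighted_sum_less_singleton[OF r(1)] by simp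
  next
    case False
    have "odd (l r)" "3 \<le> l r" using l_odd[OF r(1)] l_ge[OF r(1)] .
    moreover have "l r \<noteq> 9" using exponent_prime[OF r(1)] by auto
    moreover have "l r \<noteq> 4" "l r \<noteq> 6" "l r \<noteq> 8" "l r \<noteq> 10" using \<open>odd (l r)\<close> by auto
    ultimately consider "l r = 3" | "l r = 5 \<or> l r = 7" | "11 \<le> l r" by linarith
    then show ?thesis
    proof cases
      case 1
      then show ?thesis using weighted_sum_less_3[OF r(1) _ False] by simp
    next
      case 2
      then show ?thesis using weighted_sum_less_5_7[OF r(1) 2 min False] weighted_sum_le by linarith
    next
      case 3
      then have "11 \<le> l x" if "x \<in> A" for x using min[OF that] by simp
      then show ?thesis using weighted_sum_less_large[OF ne] weighted_sum_le by fastforce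
    qed
  qed
qed

end

section \<open>The final contradiction and the conclusion\<close>

text \<open>\<open>2 * W\<close> and \<Lambda> are congruent modulo \<open>p\<close>, yet
  \<open>\<Lambda> < 2 * W < p\<close>; for empty \<open>A\<close> they are 0 and 1.\<close>

lemma sigma_chain_impossible:
  fixes p a s :: nat
  assumes p: "prime p" "odd p" and a: "a > 0" and s: "s > 0" "\<not> p dvd s"
    and five: "\<And>u. prime u \<Longrightarrow> u dvd s \<Longrightarrow> 5 \<le> u"
    and eq: "sigma (s\<^sup>2) = p ^ (2 * a)" "sigma (p ^ (2 * a)) + 1 = 2 * s\<^sup>2"
  shows False
proof -
  define l where "l = (\<lambda>r. 2 * multiplicity r s + 1)"
  define A where "A = {r \<in> prime_factors s. (r - 1) * p + 1 = r ^ l r}"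
  define W where "W = (\<Sum>r\<in>A. (r - 1) * (l r - 1) * (\<Prod>x\<in>A - {r}. l x))"
  define \<Lambda> where "\<Lambda> = (\<Prod>r\<in>A. l r)"
  have "[2 * (\<Sum>r\<in>A. int ((r - 1) * (l r - 1) * (\<Prod>x\<in>A - {r}. l x))) = int (\<Prod>r\<in>A. l r)] (mod int p)"
    unfolding A_def l_def by (rule fermat_quotient_relation[OF p a s eq])
  then have "[int (2 * W) = int \<Lambda>] (mod int p)"
    unfolding W_def \<Lambda>_def by (simp only: of_nat_mult of_nat_sum of_nat_numeral)
  then have cong: "[2 * W = \<Lambda>] (mod p)" by (simp only: cong_int_iff)
  have finA: "finite A" unfolding A_def by auto
  show False
  proof (cases "A = {}")
    case True
    then have "[0 = 1] (mod p)" using cong unfolding W_def \<Lambda>_def by simp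
    then show False using p by (auto simp: cong_def mod_eq_0_iff_dvd dest!: sym)
  next
    case False
    have A: "prime r" "5 \<le> r" "odd (l r)" "3 \<le> l r" "(r - 1) * p + 1 = r ^ l r" if "r \<in> A" for r
    proof -
      have r: "prime r" "r dvd s" using that unfolding A_def by auto
      then show "prime r" "5 \<le> r" using five by auto
      show "odd (l r)" by (simp add: l_def)
      show "3 \<le> l r" using prime_multiplicity_gt_zero_iff[of r s] r s by (simp add: l_def)
      show "(r - 1) * p + 1 = r ^ l r" using that unfolding A_def by blast
    qed
    have "\<Lambda> < 2 * W" unfolding W_def \<Lambda>_def
      by (rule weighted_sum_greater[OF p(1) finA A False])
    moreover have "2 * W < p" unfolding W_def
      by (rule weighted_sum_less[OF p(1) finA A False])
    ultimately show False using cong by (simp add: cong_def)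
  qed
qed

theorem theorem5:
  fixes N q k n :: nat
  assumes "eulerian_form N q k n"
    and "\<forall>u. prime u \<and> u dvd N \<longrightarrow> u \<ge> 5"
  shows "q < n"
proof (rule ccontr)
  assume "\<not> q < n"
  then have ge: "n \<le> q" by simp
  have N: "sigma N = 2 * N" "N = q ^ k * n\<^sup>2" "prime q" "k mod 4 = 1" "n > 0" "coprime q n"
    using assms(1) by (auto simp: eulerian_form_def perfect_def)
  have five: "5 \<le> u" if "prime u" "u dvd n" for u
    using assms(2) that by (auto simp: N(2) power2_eq_square)
  have k0: "k > 0" using N(4) by (cases k) auto
  then have q5: "5 \<le> q" using assms(2) N(3) by (simp add: N(2))
  have q0: "q > 0" using q5 by simp
  have eq: "sigma (q ^ k) * sigma (n\<^sup>2) = 2 * (q ^ k * n\<^sup>2)"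
    using N q0 sigma_mult[of "q ^ k" "n\<^sup>2"] by simp
  have k1: "k = 1"
  proof (rule ccontr)
    \<comment> \<open>\<open>sigma (q ^ k)\<close> is prime to \<open>q\<close>, so it divides
      \<open>2 * n\<^sup>2\<close>; but it exceeds \<open>q ^ 3\<close>, which is at least
      \<open>2 * n\<^sup>2\<close> when \<open>n \<le> q\<close>.\<close>
    assume "k \<noteq> 1"
    then have k5: "5 \<le> k" using N(4) k0 by presburger
    have "(q - 1) * sigma (q ^ k) + 1 = q * q ^ k"
      using sigma_prime_power_geometric[OF N(3), of k] by simp
    then have "coprime q (sigma (q ^ k))"
      by (metis coprime_1_right coprime_add_one_left coprime_commute coprime_mult_left_iff coprime_mult_right_iff)
    then have "coprime (sigma (q ^ k)) (q ^ k)" by (simp add: coprime_commute)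
    moreover have "sigma (q ^ k) dvd q ^ k * (2 * n\<^sup>2)"
      using eq by (metis dvd_triv_left mult.left_commute)
    ultimately have "sigma (q ^ k) dvd 2 * n\<^sup>2" by (simp add: coprime_dvd_mult_right_iff)
    then have "sigma (q ^ k) \<le> 2 * n\<^sup>2" using N(5) by (intro dvd_imp_le) auto
    moreover have "q ^ k < sigma (q ^ k)" using N(3) k0 by (rule sigma_prime_power_greater)
    moreover have "q ^ 3 \<le> q ^ k" using k5 q5 by (intro power_increasing) auto
    ultimately have "q * q\<^sup>2 < 2 * n\<^sup>2" by (simp add: power3_eq_cube power2_eq_square)
    also have "\<dots> \<le> q * q\<^sup>2" using ge q5 by (intro mult_le_mono power_mono) auto
    finally show False by simp
  qed
  have "sigma q = q + 1"
    using sigma_prime_power[OF N(3), of 1] by simp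
  then have "(q + 1) * sigma (n\<^sup>2) = 2 * q * n\<^sup>2" using eq k1 by simp
  then obtain p a s where *: "prime p" "p dvd n" "a > 0" "n = p ^ a * s" "\<not> p dvd s"
    "sigma (s\<^sup>2) = p ^ (2 * a)" "sigma (p ^ (2 * a)) + 1 = 2 * s\<^sup>2"
    using odd_perfect_reduction[OF N(3,5) _ ge five] by metis
  have "odd p" using prime_odd_nat[OF *(1)] five[OF *(1,2)] by simp
  moreover have "s > 0" using *(4) N(5) by (cases s) auto
  moreover have "5 \<le> u" if "prime u" "u dvd s" for u
    using five that *(4) by simp
  ultimately show False using sigma_chain_impossible * by blast
qed

end
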